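(* Let $\mathscr{I}=(F,C,d,m,\mathscr{F})$ be an instance of the Robust $\mathscr{F}$-Supplier problem. Let $\mathcal{A}$ be an algorithm that solves (i.e. returns an optimal solution of) every $\mathscr{F}$-PCM instance $\mathscr{J}=(F,\mathscr{F},\mathscr{P},\mathsf{val})$ with $|\mathsf{val}|\le |C|$, in time bounded by $T_{\mathcal{A}}(\mathscr{J})$. Then there is a $3$-approximation algorithm for the Robust $\mathscr{F}$-Supplier instance $\mathscr{I}$ that runs in time $\mathrm{poly}(|\mathscr{I}|)\,T_{\mathcal{A}}(\mathscr{J})$.
   Context: Robust $\mathscr{F}$-Supplier problem: the input is a finite set of points $X=F\cup C$ ($F$ = facilities, $C$ = customers) with a metric $d:X\times X\to\mathbb{R}_{\ge 0}$, a down-closed family $\mathscr{F}\subseteq 2^F$ (if $A\in\mathscr{F}$ and $B\subseteq A$ then $B\in\mathscr{F}$), and an integer $m\in\{0,1,\dots,|C|\}$. For $v\in X$ and $S\subseteq F$ let $d(v,S)=\min_{u\in S}d(v,u)$ (with $d(v,\emptyset)=+\infty$). The goal is to find $S\in\mathscr{F}$ and $T\subseteq C$ with $|T|\ge m$ minimizing $\max_{u\in T}d(u,S)$; the optimum value is denoted $\mathsf{opt}(\mathscr{I})$. A $3$-approximation algorithm returns $S\in\mathscr{F}$ and $T\subseteq C$ with $|T|\ge m$ and $\max_{u\in T}d(u,S)\le 3\,\mathsf{opt}(\mathscr{I})$. $\mathscr{F}$-PCM problem: the input is $\mathscr{J}=(F,\mathscr{F},\mathscr{P},\mathsf{val})$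 where $\mathscr{F}\subseteq 2^F$ is down-closed, $\mathscr{P}$ is a sub-partition of $F$ (a collection of pairwise disjoint subsets of $F$), and $\mathsf{val}:F\to\{0,1,2,\dots\}$ is an integer function, with maximum value denoted $|\mathsf{val}|$, that is constant on each part of $\mathscr{P}$. The goal is to compute $\mathsf{opt}(\mathscr{J})=\max\{\mathsf{val}(S): S\in\mathscr{F},\ |S\cap A|\le 1\ \forall A\in\mathscr{P}\}$ together with a maximizer, where $\mathsf{val}(S)=\sum_{f\in S}\mathsf{val}(f)$. *)

theory Defs
  imports
    "HOL-Analysis.Abstract_Metric_Spaces"
    "HOL-Library.Extended_Nonnegative_Real"
    "HOL-Library.Disjoint_Sets"
    "HOL-Computational_Algebra.Polynomial"
begin

section \<open>The model of computation\<close>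

text \<open>
  Algorithms are WHILE programs over binary trees, in the style of N. D. Jones
  ("Computability and Complexity from a Programming Perspective"): trees are immutable and
  shared, so building a pair and taking it apart is a constant-time operation, and running times
  are polynomially related to those of Turing machines. There are two additions.

  \<^item> A leaf can hold a real number (an exact distance). The only operation on real numbers is a
    unit-cost comparison; in particular there is no arithmetic on them, and a program contains no
    real constants.

  \<^item> A program may put questions to a predicate \<open>orc\<close> at unit cost. This covers families of sets
    that are given by an oracle, for instance a membership oracle.
\<close>

datatype tree = Tip | Atom real | Node tree tree

fun cells :: "tree \<Rightarrow> nat" where
  "cells Tip = 1"
| "cells (Atom r) = 1"
| "cells (Node a b) = 1 + cells a + cells b"

datatype expr =
    Var nat
  | Empty
  | Pair expr expr
  | Fst expr
  | Snd expr
  | Leq expr expr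
  | Ask expr

type_synonym store = "nat \<Rightarrow> tree"

text \<open>As a truth value, \<^term>\<open>Tip\<close> is false and every other tree is true.\<close>

definition bool_tree :: "bool \<Rightarrow> tree" where
  "bool_tree b = (if b then Node Tip Tip else Tip)"

fun tree_fst :: "tree \<Rightarrow> tree" where
  "tree_fst (Node a b) = a"
| "tree_fst _ = Tip"

fun tree_snd :: "tree \<Rightarrow> tree" where
  "tree_snd (Node a b) = b"
| "tree_snd _ = Tip"

fun tree_leq :: "tree \<Rightarrow> tree \<Rightarrow> bool" where
  "tree_leq (Atom r) (Atom s) = (r \<le> s)"
| "tree_leq _ _ = False"

fun eval_expr :: "(tree \<Rightarrow> bool) \<Rightarrow> expr \<Rightarrow> store \<Rightarrow> tree" where
  "eval_expr orc (Var x) s = s x"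
| "eval_expr orc Empty s = Tip"
| "eval_expr orc (Pair e f) s = Node (eval_expr orc e s) (eval_expr orc f s)"
| "eval_expr orc (Fst e) s = tree_fst (eval_expr orc e s)"
| "eval_expr orc (Snd e) s = tree_snd (eval_expr orc e s)"
| "eval_expr orc (Leq e f) s = bool_tree (tree_leq (eval_expr orc e s) (eval_expr orc f s))"
| "eval_expr orc (Ask e) s = bool_tree (orc (eval_expr orc e s))"

fun expr_cost :: "expr \<Rightarrow> nat" where
  "expr_cost (Var x) = 1"
| "expr_cost Empty = 1"
| "expr_cost (Pair e f) = 1 + expr_cost e + expr_cost f"
| "expr_cost (Fst e) = 1 + expr_cost e"
| "expr_cost (Snd e) = 1 + expr_cost e"
| "expr_cost (Leq e f) = 1 + expr_cost e + expr_cost f"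
| "expr_cost (Ask e) = 1 + expr_cost e"

datatype com =
    Assign nat expr
  | Seq com com
  | If expr com com
  | While expr com
  | Call nat com expr

definition start_store :: "tree \<Rightarrow> store" where
  "start_store a = (\<lambda>_. Tip)(0 := a)"

text \<open>
  \<open>exec orc c s t s'\<close>: started in store \<open>s\<close>, the command \<open>c\<close> halts after \<open>t\<close> steps in store \<open>s'\<close>.
  \<open>Call x c e\<close> runs \<open>c\<close> as a non-recursive procedure with a fresh store of its own: the argument is
  passed, and the result returned, in variable 0.
\<close>

inductive exec :: "(tree \<Rightarrow> bool) \<Rightarrow> com \<Rightarrow> store \<Rightarrow> nat \<Rightarrow> store \<Rightarrow> bool" for orc where
  Assign: "exec orc (Assign x e) s (1 + expr_cost e) (s(x := eval_expr orc e s))"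
| Seq: "exec orc c s t s' \<Longrightarrow> exec orc c' s' t' s'' \<Longrightarrow> exec orc (Seq c c') s (t + t') s''"
| IfTrue: "eval_expr orc e s \<noteq> Tip \<Longrightarrow> exec orc c s t s' \<Longrightarrow>
    exec orc (If e c c') s (1 + expr_cost e + t) s'"
| IfFalse: "eval_expr orc e s = Tip \<Longrightarrow> exec orc c' s t s' \<Longrightarrow>
    exec orc (If e c c') s (1 + expr_cost e + t) s'"
| WhileFalse: "eval_expr orc e s = Tip \<Longrightarrow> exec orc (While e c) s (1 + expr_cost e) s"
| WhileTrue: "eval_expr orc e s \<noteq> Tip \<Longrightarrow> exec orc c s t s' \<Longrightarrow>
    exec orc (While e c) s' t' s'' \<Longrightarrow> exec orc (While e c) s (1 + expr_cost e + t + t') s''"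
| Call: "exec orc c (start_store (eval_expr orc e s)) t s' \<Longrightarrow>
    exec orc (Call x c e) s (1 + expr_cost e + t) (s(x := s' 0))"

definition runs :: "(tree \<Rightarrow> bool) \<Rightarrow> com \<Rightarrow> tree \<Rightarrow> tree \<Rightarrow> nat \<Rightarrow> bool" where
  "runs orc c a b t \<longleftrightarrow> (\<exists>s'. exec orc c (start_store a) t s' \<and> s' 0 = b)"


section \<open>Data representation\<close>

text \<open>
  \<open>R x a\<close> says that the tree \<open>a\<close> represents the object \<open>x\<close>. Natural numbers are written in unary;
  the numbers that occur in the instances below are labels of points and numbers bounded by the
  number of customers. A finite set is represented by a listing of its elements without
  repetitions, in any order, and a function on a finite domain by its graph.
\<close>

fun nat_tree :: "nat \<Rightarrow> tree" where
  "nat_tree 0 = Tip"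
| "nat_tree (Suc n) = Node Tip (nat_tree n)"

fun list_tree :: "tree list \<Rightarrow> tree" where
  "list_tree [] = Tip"
| "list_tree (a # as) = Node a (list_tree as)"

definition repr_nat :: "nat \<Rightarrow> tree \<Rightarrow> bool" where
  "repr_nat n a \<longleftrightarrow> a = nat_tree n"

definition repr_real :: "real \<Rightarrow> tree \<Rightarrow> bool" where
  "repr_real r a \<longleftrightarrow> a = Atom r"

definition repr_pair ::
  "('a \<Rightarrow> tree \<Rightarrow> bool) \<Rightarrow> ('b \<Rightarrow> tree \<Rightarrow> bool) \<Rightarrow> 'a \<times> 'b \<Rightarrow> tree \<Rightarrow> bool" where
  "repr_pair R Q p a \<longleftrightarrow> (\<exists>b c. a = Node b c \<and> R (fst p) b \<and> Q (snd p) c)"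

definition repr_set :: "('a \<Rightarrow> tree \<Rightarrow> bool) \<Rightarrow> 'a set \<Rightarrow> tree \<Rightarrow> bool" where
  "repr_set R A a \<longleftrightarrow>
     (\<exists>xs as. distinct xs \<and> set xs = A \<and> list_all2 R xs as \<and> a = list_tree as)"

definition repr_fun ::
  "('a \<Rightarrow> tree \<Rightarrow> bool) \<Rightarrow> ('b \<Rightarrow> tree \<Rightarrow> bool) \<Rightarrow> 'a set \<Rightarrow> ('a \<Rightarrow> 'b) \<Rightarrow> tree \<Rightarrow> bool" where
  "repr_fun R Q D f a \<longleftrightarrow> repr_set (repr_pair R Q) ((\<lambda>x. (x, f x)) ` D) a"


section \<open>The Robust F-Supplier problem\<close>

definition down_closed :: "'a set set \<Rightarrow> bool" where
  "down_closed \<F> \<longleftrightarrow> (\<forall>A\<in>\<F>. \<forall>B\<subseteq>A. B \<in> \<F>)"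

text \<open>
  Points are natural numbers. A customer may also be a facility.
\<close>

record supplier =
  facs :: "nat set"
  custs :: "nat set"
  metr :: "nat \<Rightarrow> nat \<Rightarrow> real"
  demand :: nat
  fam :: "nat set set"

text \<open>
  The locale predicate \<^const>\<open>Metric_space\<close> also asks that the total function be symmetric and
  nonnegative outside of the point set; those values are irrelevant, and every metric on the
  points extends in this way.
\<close>

definition supplier_instance :: "supplier \<Rightarrow> bool" where
  "supplier_instance I \<longleftrightarrow>
     finite (facs I) \<and> finite (custs I) \<and>
     Metric_space (facs I \<union> custs I) (metr I) \<and>
     demand I \<le> card (custs I) \<and>
     fam I \<subseteq> Pow (facs I) \<and> down_closed (fam I)"

text \<open>The infimum over the empty set is \<open>\<infinity>\<close>; the supremum over the empty set is 0.\<close>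

definition set_dist :: "supplier \<Rightarrow> nat \<Rightarrow> nat set \<Rightarrow> ennreal" where
  "set_dist I v S = (INF u\<in>S. ennreal (metr I v u))"

definition supplier_cost :: "supplier \<Rightarrow> nat set \<times> nat set \<Rightarrow> ennreal" where
  "supplier_cost I = (\<lambda>(S, U). SUP u\<in>U. set_dist I u S)"

definition supplier_feasible :: "supplier \<Rightarrow> (nat set \<times> nat set) set" where
  "supplier_feasible I =
     {(S, U). S \<in> fam I \<and> U \<subseteq> custs I \<and> demand I \<le> card U}"

definition supplier_opt :: "supplier \<Rightarrow> ennreal" where
  "supplier_opt I = (INF X\<in>supplier_feasible I. supplier_cost I X)"

definition approx_solution :: "ennreal \<Rightarrow> supplier \<Rightarrow> nat set \<times> nat set \<Rightarrow> bool" where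
  "approx_solution \<alpha> I X \<longleftrightarrow>
     X \<in> supplier_feasible I \<and> supplier_cost I X \<le> \<alpha> * supplier_opt I"

text \<open>
  The family is usually far too large to be listed. The input contains an arbitrary tree \<open>\<phi>\<close> that
  describes it; no particular way of describing families is prescribed.
\<close>

definition supplier_input :: "tree \<Rightarrow> supplier \<Rightarrow> tree \<Rightarrow> bool" where
  "supplier_input \<phi> I a \<longleftrightarrow>
     (\<exists>f c d m. a = list_tree [f, c, d, m, \<phi>] \<and>
        repr_set repr_nat (facs I) f \<and>
        repr_set repr_nat (custs I) c \<and>
        repr_fun (repr_pair repr_nat repr_nat) repr_real
          ((facs I \<union> custs I) \<times> (facs I \<union> custs I)) (\<lambda>(x, y). metr I x y) d \<and>
        repr_nat (demand I) m)"

definition supplier_output :: "nat set \<times> nat set \<Rightarrow> tree \<Rightarrow> bool" where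
  "supplier_output = repr_pair (repr_set repr_nat) (repr_set repr_nat)"


section \<open>The F-PCM problem\<close>

record pcm =
  pcm_facs :: "nat set"
  pcm_fam :: "nat set set"
  pcm_parts :: "nat set set"
  pcm_val :: "nat \<Rightarrow> nat"

definition pcm_instance :: "pcm \<Rightarrow> bool" where
  "pcm_instance J \<longleftrightarrow>
     finite (pcm_facs J) \<and>
     pcm_fam J \<subseteq> Pow (pcm_facs J) \<and> down_closed (pcm_fam J) \<and>
     pcm_parts J \<subseteq> Pow (pcm_facs J) \<and> disjoint (pcm_parts J) \<and>
     (\<forall>A\<in>pcm_parts J. \<forall>f\<in>A. \<forall>g\<in>A. pcm_val J f = pcm_val J g)"

definition pcm_feasible :: "pcm \<Rightarrow> nat set set" where
  "pcm_feasible J = {S \<in> pcm_fam J. \<forall>A\<in>pcm_parts J. card (S \<inter> A) \<le> 1}"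

definition pcm_value :: "pcm \<Rightarrow> nat set \<Rightarrow> nat" where
  "pcm_value J S = (\<Sum>f\<in>S. pcm_val J f)"

definition pcm_opt :: "pcm \<Rightarrow> nat" where
  "pcm_opt J = Max (pcm_value J ` pcm_feasible J)"

definition pcm_optimal :: "pcm \<Rightarrow> nat set \<Rightarrow> bool" where
  "pcm_optimal J S \<longleftrightarrow> S \<in> pcm_feasible J \<and> pcm_value J S = pcm_opt J"

definition pcm_input :: "tree \<Rightarrow> pcm \<Rightarrow> tree \<Rightarrow> bool" where
  "pcm_input \<phi> J a \<longleftrightarrow>
     (\<exists>f p v. a = list_tree [f, \<phi>, p, v] \<and>
        repr_set repr_nat (pcm_facs J) f \<and>
        repr_set (repr_set repr_nat) (pcm_parts J) p \<and>
        repr_fun repr_nat repr_nat (pcm_facs J) (pcm_val J) v)"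

definition pcm_solves_within ::
  "(tree \<Rightarrow> bool) \<Rightarrow> tree \<Rightarrow> com \<Rightarrow> pcm \<Rightarrow> nat \<Rightarrow> bool" where
  "pcm_solves_within orc \<phi> A J n \<longleftrightarrow>
     (\<forall>a. pcm_input \<phi> J a \<longrightarrow>
        (\<exists>b t S. runs orc A a b t \<and> t \<le> n \<and> repr_set repr_nat S b \<and> pcm_optimal J S))"

text \<open>
  The PCM instances with the facilities and the family of \<open>I\<close> whose values are at most the number
  of customers of \<open>I\<close>.
\<close>

definition pcm_instances_of :: "supplier \<Rightarrow> pcm set" where
  "pcm_instances_of I =
     {J. pcm_instance J \<and> pcm_facs J = facs I \<and> pcm_fam J = fam I \<and>
         (\<forall>f\<in>facs I. pcm_val J f \<le> card (custs I))}"

end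

(*
  Fix a guess r for the optimum and let two customers be linked if some facility is within r of both.
  Given any order of the customers that have a facility within r, pick greedily a maximal set of
  pairwise unlinked centres and send every customer to the first centre linked to it. The facilities
  near distinct centres are disjoint, so with the cluster sizes as values this is an F-PCM instance,
  and a solution of value at least m gives radius 3r by the triangle inequality.

  Instead of the ellipsoid method, the order is learned by a perceptron. Let X be the set of
  customers that an optimal solution covers within r. If the F-PCM optimum is below m, then fewer
  than |X| customers are sent to a centre in X, i.e. the vector 1 - (cluster size of v) has sum at
  least 1 over X. The customers are ordered by the sum y of these vectors over the previous rounds,
  largest entry first. As a customer is only sent to a centre with at least the same y, the new
  vector has nonpositive inner product with y; hence after t failed rounds |y|^2 <= t n^2 although
  y has sum at least t over X, and Cauchy-Schwarz gives t <= n^3. Only integers are added, and real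
  numbers are only compared, as the model demands.
*)
theory Submission
  imports Defs
begin

section \<open>Polynomial time on encoded data\<close>

text \<open>The program knows neither the optimum nor the optimal cover X. This is harmless: the
  progress estimate holds for all sufficiently large covers at once, and X occurs in the analysis
  only, as the vector against which the perceptron is measured. A guess that is too small may fail
  in all its rounds, and nothing tests for this: every guess gets more rounds than a correct one can
  fail, and the smallest successful guess wins. So one flat list of guesses drives a single loop.
  The model shapes the rest. Without addition of reals, a link is witnessed by a facility instead of
  a bound 2r on the distance, and the guesses are the entries of the distance table. The solver is
  not a function known to be polynomial, so the size of the state is bounded by an explicit
  invariant instead of by composition. Its time may vary with the instance; the whole run is charged
  to one with the largest bound. All else consists of fixed functions whose programs come from
  closure properties, so the polynomial does not depend on the solver.\<close>

class encodable =
  fixes enc :: "'a \<Rightarrow> tree"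

instantiation tree :: encodable
begin
definition enc_tree :: "tree \<Rightarrow> tree" where [simp]: "enc_tree a = a"
instance ..
end

instantiation nat :: encodable
begin
definition enc_nat :: "nat \<Rightarrow> tree" where [simp]: "enc_nat = nat_tree"
instance ..
end

instantiation real :: encodable
begin
definition enc_real :: "real \<Rightarrow> tree" where [simp]: "enc_real = Atom"
instance ..
end

instantiation bool :: encodable
begin
definition enc_bool :: "bool \<Rightarrow> tree" where [simp]: "enc_bool = bool_tree"
instance ..
end

instantiation prod :: (encodable, encodable) encodable
begin
definition enc_prod :: "'a \<times> 'b \<Rightarrow> tree" where
  [simp]: "enc_prod p = Node (enc (fst p)) (enc (snd p))"
instance ..
end

instantiation list :: (encodable) encodable
begin
definition enc_list :: "'a list \<Rightarrow> tree" where "enc_list xs = list_tree (map enc xs)"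
instance ..
end

lemma enc_Nil [simp]: "enc [] = Tip"
  by (simp add: enc_list_def)

lemma enc_Cons [simp]: "enc (x # xs) = Node (enc x) (enc xs)"
  by (simp add: enc_list_def)

section \<open>Sizes of encodings\<close>

abbreviation sz :: "'a::encodable \<Rightarrow> nat" where
  "sz x \<equiv> cells (enc x)"

lemma length_le_sz: "length xs \<le> sz xs"
  by (induction xs) auto

lemma sz_elem: "x \<in> set xs \<Longrightarrow> sz x \<le> sz xs"
  by (induction xs) auto

lemma sz_append: "sz (xs @ ys) + 1 = sz xs + sz ys"
  by (induction xs) auto

lemma sz_map_le:
  assumes "\<And>x. x \<in> set xs \<Longrightarrow> sz (f x) \<le> B"
  shows "sz (map f xs) \<le> 1 + length xs * (B + 1)"
  using assms
proof (induction xs)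
  case (Cons x xs)
  have "sz (f x) \<le> B" using Cons.prems by simp
  moreover have "sz (map f xs) \<le> 1 + length xs * (B + 1)" using Cons by simp
  ultimately show ?case by simp
qed simp

text \<open>Written as a sum over the elements, the size ignores their order. This is how an answer
  of the PCM solver gets a size bound: it is a distinct list of facilities of the input.\<close>

lemma sz_distinct:
  fixes xs :: "'a::encodable list"
  assumes "distinct xs" "set xs \<subseteq> set ys"
  shows "sz xs \<le> sz ys"
proof -
  have eq: "sz zs = 1 + sum_list (map (\<lambda>x. Suc (sz x)) zs)" for zs :: "'a list"
    by (induction zs) auto
  have "sum_list (map (\<lambda>x. Suc (sz x)) xs) = (\<Sum>x\<in>set xs. Suc (sz x))"
    using assms(1) by (rule sum_list_distinct_conv_sum_set)
  also have "\<dots> \<le> (\<Sum>x\<in>set (remdups ys). Suc (sz x))"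
    using assms(2) by (intro sum_mono2) auto
  also have "\<dots> = sum_list (map (\<lambda>x. Suc (sz x)) (remdups ys))"
    by (rule sum_list_distinct_conv_sum_set[symmetric]) simp
  also have "\<dots> \<le> sum_list (map (\<lambda>x. Suc (sz x)) ys)"
    by (induction ys) auto
  finally show ?thesis unfolding eq[of xs] eq[of ys] by simp
qed

lemma poly_mono_nat: "m \<le> n \<Longrightarrow> poly p m \<le> poly p n" for p :: "nat poly"
  by (induction p) (auto intro: add_mono mult_mono)

text \<open>Upper bounds instead of exact times let both branches of a conditional, or rounds of
  different length, share one bound.\<close>

definition exec_within :: "(tree \<Rightarrow> bool) \<Rightarrow> com \<Rightarrow> store \<Rightarrow> nat \<Rightarrow> store \<Rightarrow> bool" where
  "exec_within orc c s n s' \<longleftrightarrow> (\<exists>t\<le>n. exec orc c s t s')"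

definition runs_within :: "(tree \<Rightarrow> bool) \<Rightarrow> com \<Rightarrow> tree \<Rightarrow> tree \<Rightarrow> nat \<Rightarrow> bool" where
  "runs_within orc c a b n \<longleftrightarrow> (\<exists>t\<le>n. runs orc c a b t)"

lemma runs_within_mono: "runs_within orc c a b m \<Longrightarrow> m \<le> n \<Longrightarrow> runs_within orc c a b n"
  unfolding runs_within_def by (meson le_trans)

lemma exec_within_mono: "exec_within orc c s m s' \<Longrightarrow> m \<le> n \<Longrightarrow> exec_within orc c s n s'"
  unfolding exec_within_def by (meson le_trans)

lemma runs_withinI: "exec_within orc c (start_store a) n s' \<Longrightarrow> s' 0 = b \<Longrightarrow> runs_within orc c a b n"
  unfolding exec_within_def runs_within_def runs_def by blast

lemma exec_within_Assign:
  "exec_within orc (Assign x e) s (1 + expr_cost e) (s(x := eval_expr orc e s))"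
  unfolding exec_within_def by (blast intro: exec.Assign)

lemma exec_within_Seq:
  "exec_within orc c s m s' \<Longrightarrow> exec_within orc d s' n s'' \<Longrightarrow> exec_within orc (Seq c d) s (m + n) s''"
  unfolding exec_within_def by (meson add_mono exec.Seq)

lemma exec_within_If:
  assumes "eval_expr orc e s \<noteq> Tip \<Longrightarrow> exec_within orc c s n s'"
    and "eval_expr orc e s = Tip \<Longrightarrow> exec_within orc d s n s'"
  shows "exec_within orc (If e c d) s (1 + expr_cost e + n) s'"
  using assms unfolding exec_within_def
  by (cases "eval_expr orc e s = Tip") (meson add_left_mono exec.IfTrue exec.IfFalse)+

lemma exec_within_While_Tip:
  "eval_expr orc e s = Tip \<Longrightarrow> exec_within orc (While e c) s (1 + expr_cost e) s"
  unfolding exec_within_def by (blast intro: exec.WhileFalse)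

lemma exec_within_While:
  "eval_expr orc e s \<noteq> Tip \<Longrightarrow> exec_within orc c s m s' \<Longrightarrow>
   exec_within orc (While e c) s' n s'' \<Longrightarrow>
   exec_within orc (While e c) s (1 + expr_cost e + m + n) s''"
  unfolding exec_within_def by (meson add_mono add_left_mono exec.WhileTrue)

lemma exec_within_Call:
  assumes "eval_expr orc e s = a" "runs_within orc c a b n"
    and "1 + expr_cost e + n \<le> m" "s' = s(x := b)"
  shows "exec_within orc (Call x c e) s m s'"
proof -
  obtain t s'' where "t \<le> n" "exec orc c (start_store a) t s''" "s'' 0 = b"
    using assms(2) unfolding runs_within_def runs_def by blast
  moreover from this have "exec orc (Call x c e) s (1 + expr_cost e + t) s'"
    using exec.Call[of orc c e s t s'' x] assms(1,4) by simp
  ultimately show ?thesis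
    unfolding exec_within_def using assms(3) by (metis add_left_mono le_trans)
qed

text \<open>The output size needs a bound of its own: trees are shared, so \<open>t\<close>
  repetitions of \<open>Pair x x\<close> build a tree with exponentially many cells in time linear
  in \<open>t\<close>. The program must work under every \<open>orc\<close>, because the final
  program is chosen before the oracle.\<close>

definition computes :: "com \<Rightarrow> ('a::encodable \<Rightarrow> 'b::encodable) \<Rightarrow> nat poly \<Rightarrow> bool" where
  "computes c f p \<longleftrightarrow>
     (\<forall>x. sz (f x) \<le> poly p (sz x) \<and>
          (\<forall>orc. runs_within orc c (enc x) (enc (f x)) (poly p (sz x))))"

definition ptime :: "('a::encodable \<Rightarrow> 'b::encodable) \<Rightarrow> bool" where
  "ptime f \<longleftrightarrow> (\<exists>c p. computes c f p)"

lemma computes_sz: "computes c f p \<Longrightarrow> sz x \<le> n \<Longrightarrow> sz (f x) \<le> poly p n"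
  unfolding computes_def by (meson le_trans poly_mono_nat)

lemma computes_run:
  "computes c f p \<Longrightarrow> sz x \<le> n \<Longrightarrow> runs_within orc c (enc x) (enc (f x)) (poly p n)"
  unfolding computes_def by (meson runs_within_mono poly_mono_nat)

lemma ptimeI:
  assumes "\<And>x. sz (f x) \<le> poly p (sz x)"
    and "\<And>orc x. runs_within orc c (enc x) (enc (f x)) (poly p (sz x))"
  shows "ptime f"
  using assms unfolding ptime_def computes_def by blast

lemma ptimeE:
  assumes "ptime f"
  obtains c p where "computes c f p"
  using assms unfolding ptime_def by blast

named_theorems ptime_intros

lemma ptime_expr:
  assumes "\<And>orc x. eval_expr orc e (start_store (enc x)) = enc (f x)"
    and "\<And>x. sz (f x) \<le> poly p (sz x)"
  shows "ptime f"
proof (rule ptimeI)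
  show "sz (f x) \<le> poly (p + [:1 + expr_cost e:]) (sz x)" for x
    using assms(2)[of x] by simp
  show "runs_within orc (Assign 0 e) (enc x) (enc (f x)) (poly (p + [:1 + expr_cost e:]) (sz x))"
    for orc x
    by (rule runs_withinI[OF exec_within_mono[OF exec_within_Assign]]) (auto simp: assms(1))
qed

text \<open>Programs only see trees, and types overlap there: \<open>0\<close>, \<open>[]\<close>,
  \<open>False\<close> and \<open>Tip\<close> coincide, a list cell is a pair, a unary number is a
  list of \<open>Tip\<close>s. Results therefore move between types without any computation.\<close>

lemma ptime_recode:
  assumes "ptime f" "\<And>x. enc (g x) = enc (f x)"
  shows "ptime g"
  using assms unfolding ptime_def computes_def by auto

lemma ptime_id [ptime_intros]: "ptime (\<lambda>x. x)"
  by (rule ptime_expr[of "Var 0" _ "[:0, 1:]"]) (auto simp: start_store_def)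

lemma ptime_comp:
  fixes f :: "'b::encodable \<Rightarrow> 'c::encodable" and g :: "'a::encodable \<Rightarrow> 'b"
  assumes "ptime f" "ptime g"
  shows "ptime (\<lambda>x. f (g x))"
proof -
  obtain c p d q where f: "computes c f p" and g: "computes d g q"
    using assms by (elim ptimeE)
  let ?r = "[:4:] + q + pcompose p q"
  show ?thesis
  proof (rule ptimeI)
    show "sz (f (g x)) \<le> poly ?r (sz x)" for x
      using computes_sz[OF f computes_sz[OF g order_refl], of x] by (simp add: poly_pcompose)
    fix orc and x :: 'a
    have 1: "exec_within orc (Call 0 d (Var 0)) (start_store (enc x)) (1 + 1 + poly q (sz x))
        ((start_store (enc x))(0 := enc (g x)))"
      by (rule exec_within_Call[OF _ computes_run[OF g order_refl]]) (auto simp: start_store_def)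
    have 2: "exec_within orc (Call 0 c (Var 0)) ((start_store (enc x))(0 := enc (g x)))
        (1 + 1 + poly p (poly q (sz x))) ((start_store (enc x))(0 := enc (f (g x))))"
      by (rule exec_within_Call[OF _ computes_run[OF f computes_sz[OF g order_refl]]])
        (auto simp: start_store_def)
    show "runs_within orc (Seq (Call 0 d (Var 0)) (Call 0 c (Var 0))) (enc x) (enc (f (g x)))
        (poly ?r (sz x))"
      by (rule runs_withinI[OF exec_within_mono[OF exec_within_Seq[OF 1 2]]])
        (auto simp: poly_pcompose)
  qed
qed

lemma ptime_pair [ptime_intros]:
  fixes f :: "'a::encodable \<Rightarrow> 'b::encodable" and g :: "'a \<Rightarrow> 'c::encodable"
  assumes "ptime f" "ptime g"
  shows "ptime (\<lambda>x. (f x, g x))"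
proof -
  obtain c p d q where f: "computes c f p" and g: "computes d g q"
    using assms by (elim ptimeE)
  let ?r = "[:8:] + p + q"
  show ?thesis
  proof (rule ptimeI)
    show "sz (f x, g x) \<le> poly ?r (sz x)" for x
      using computes_sz[OF f order_refl, of x] computes_sz[OF g order_refl, of x] by simp
    fix orc and x :: 'a
    let ?s = "start_store (enc x)"
    have 1: "exec_within orc (Call 1 c (Var 0)) ?s (1 + 1 + poly p (sz x)) (?s(1 := enc (f x)))"
      by (rule exec_within_Call[OF _ computes_run[OF f order_refl]]) (auto simp: start_store_def)
    have 2: "exec_within orc (Call 0 d (Var 0)) (?s(1 := enc (f x))) (1 + 1 + poly q (sz x))
        (?s(1 := enc (f x), 0 := enc (g x)))"
      by (rule exec_within_Call[OF _ computes_run[OF g order_refl]]) (auto simp: start_store_def)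
    show "runs_within orc
        (Seq (Seq (Call 1 c (Var 0)) (Call 0 d (Var 0))) (Assign 0 (Pair (Var 1) (Var 0))))
        (enc x) (enc (f x, g x)) (poly ?r (sz x))"
      by (rule runs_withinI[OF exec_within_mono[OF
            exec_within_Seq[OF exec_within_Seq[OF 1 2] exec_within_Assign]]]) auto
  qed
qed

lemma ptime_fst [ptime_intros]: "ptime f \<Longrightarrow> ptime (\<lambda>x. fst (f x))"
  by (rule ptime_comp[of fst], rule ptime_expr[of "Fst (Var 0)" _ "[:0, 1:]"])
    (auto simp: start_store_def)

lemma ptime_snd [ptime_intros]: "ptime f \<Longrightarrow> ptime (\<lambda>x. snd (f x))"
  by (rule ptime_comp[of snd], rule ptime_expr[of "Snd (Var 0)" _ "[:0, 1:]"])
    (auto simp: start_store_def)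

lemma ptime_Nil [ptime_intros]: "ptime (\<lambda>x. [])"
  by (rule ptime_expr[of Empty _ "[:1:]"]) auto

lemma ptime_zero [ptime_intros]: "ptime (\<lambda>x. 0 :: nat)"
  by (rule ptime_expr[of Empty _ "[:1:]"]) auto

lemma ptime_False [ptime_intros]: "ptime (\<lambda>x. False)"
  by (rule ptime_expr[of Empty _ "[:1:]"]) (auto simp: bool_tree_def)

lemma ptime_True [ptime_intros]: "ptime (\<lambda>x. True)"
  by (rule ptime_expr[of "Pair Empty Empty" _ "[:3:]"]) (auto simp: bool_tree_def)

lemma ptime_Tip [ptime_intros]: "ptime (\<lambda>x. Tip)"
  by (rule ptime_expr[of Empty _ "[:1:]"]) auto

lemma ptime_Cons [ptime_intros]: "ptime f \<Longrightarrow> ptime g \<Longrightarrow> ptime (\<lambda>x. f x # g x)"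
  by (rule ptime_recode[OF ptime_pair[of f g]]) auto

lemma ptime_Suc [ptime_intros]: "ptime f \<Longrightarrow> ptime (\<lambda>x. Suc (f x))"
  by (rule ptime_recode[OF ptime_pair[OF ptime_Tip]]) auto

lemma ptime_real_le [ptime_intros]:
  assumes "ptime f" "ptime g"
  shows "ptime (\<lambda>x. f x \<le> (g x :: real))"
proof -
  have "ptime (\<lambda>p :: real \<times> real. fst p \<le> snd p)"
    by (rule ptime_expr[of "Leq (Fst (Var 0)) (Snd (Var 0))" _ "[:3:]"])
      (auto simp: start_store_def bool_tree_def)
  from ptime_comp[OF this ptime_pair[OF assms]] show ?thesis by simp
qed

text \<open>There are no closures, so \<open>g\<close> receives the environment \<open>e\<close> as
  an explicit argument; the higher-order rules below all have this form.\<close>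

lemma ptime_case_list [ptime_intros]:
  fixes L :: "'a::encodable \<Rightarrow> 'b::encodable list" and f :: "'a \<Rightarrow> 'c::encodable"
  assumes L: "ptime L" and f: "ptime f"
    and g: "ptime (\<lambda>z. g (fst z) (fst (snd z)) (snd (snd z)))"
  shows "ptime (\<lambda>e. case L e of [] \<Rightarrow> f e | x # xs \<Rightarrow> g e x xs)"
proof -
  obtain cL pL cf pf cg pg where L: "computes cL L pL" and f: "computes cf f pf"
    and g: "computes cg (\<lambda>z. g (fst z) (fst (snd z)) (snd (snd z))) pg"
    using assms by (elim ptimeE)
  let ?F = "\<lambda>e. case L e of [] \<Rightarrow> f e | x # xs \<Rightarrow> g e x xs"
  let ?q = "pf + pcompose pg ([:1, 1:] + pL)"
  let ?r = "[:8:] + pL + ?q"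
  have q: "poly pf n \<le> poly ?q n" for n by simp
  have cons: "sz (e, x, xs) \<le> poly ([:1, 1:] + pL) (sz e)" if "L e = x # xs" for e x xs
    using computes_sz[OF L order_refl, of e] that by simp
  show ?thesis
  proof (rule ptimeI)
    fix e :: 'a
    show "sz (?F e) \<le> poly ?r (sz e)"
    proof (cases "L e")
      case Nil
      then show ?thesis using computes_sz[OF f order_refl, of e] by simp
    next
      case (Cons x xs)
      show ?thesis
        using computes_sz[OF g cons[OF Cons]] Cons by (simp add: poly_pcompose)
    qed
  next
    fix orc and e :: 'a
    let ?s = "start_store (enc e)"
    let ?s' = "?s(1 := enc (L e))"
    have 1: "exec_within orc (Call 1 cL (Var 0)) ?s (1 + 1 + poly pL (sz e)) ?s'"
      by (rule exec_within_Call[OF _ computes_run[OF L order_refl]]) (auto simp: start_store_def)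
    have 2: "exec_within orc (If (Var 1) (Call 0 cg (Pair (Var 0) (Var 1))) (Call 0 cf (Var 0)))
        ?s' (1 + expr_cost (Var 1) + (4 + poly ?q (sz e))) (?s'(0 := enc (?F e)))"
    proof (rule exec_within_If)
      assume "eval_expr orc (Var 1) ?s' = Tip"
      then have Nil: "L e = []" by (cases "L e") auto
      show "exec_within orc (Call 0 cf (Var 0)) ?s' (4 + poly ?q (sz e)) (?s'(0 := enc (?F e)))"
        by (rule exec_within_Call[OF _ computes_run[OF f order_refl]])
          (auto simp: start_store_def Nil)
    next
      assume "eval_expr orc (Var 1) ?s' \<noteq> Tip"
      then obtain x xs where Cons: "L e = x # xs" by (cases "L e") auto
      show "exec_within orc (Call 0 cg (Pair (Var 0) (Var 1))) ?s' (4 + poly ?q (sz e))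
          (?s'(0 := enc (?F e)))"
        by (rule exec_within_Call[OF _ computes_run[OF g cons[OF Cons]]])
          (auto simp: start_store_def Cons poly_pcompose)
    qed
    show "runs_within orc
        (Seq (Call 1 cL (Var 0)) (If (Var 1) (Call 0 cg (Pair (Var 0) (Var 1))) (Call 0 cf (Var 0))))
        (enc e) (enc (?F e)) (poly ?r (sz e))"
      by (rule runs_withinI[OF exec_within_mono[OF exec_within_Seq[OF 1 2]]]) auto
  qed
qed

lemma sz_fold_le:
  assumes "\<And>x acc. x \<in> set xs \<Longrightarrow> sz (G x acc) \<le> sz acc + Q"
  shows "sz (fold G xs acc) \<le> sz acc + length xs * Q"
  using assms
proof (induction xs arbitrary: acc)
  case (Cons x xs)
  have "sz (fold G xs (G x acc)) \<le> sz (G x acc) + length xs * Q"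
    using Cons by simp
  also have "\<dots> \<le> sz acc + Q + length xs * Q"
    using Cons.prems by simp
  finally show ?case by simp
qed simp

text \<open>Variable 0 holds the environment, 1 the rest of the list, 2 the accumulator. The step
  takes time \<open>K\<close> only while the accumulator has size at most \<open>B\<close>;
  reserving \<open>Q\<close> for each remaining element makes this hypothesis survive the induction.
  An iteration costs \<open>K + 12\<close>: 2 for the test, 7 for passing the triple, 3 for
  advancing the list.\<close>

lemma exec_within_fold:
  fixes G :: "'a::encodable \<Rightarrow> 'b::encodable \<Rightarrow> 'b" and e :: "'c::encodable"
  defines "body c \<equiv> Seq (Call 2 c (Pair (Var 0) (Pair (Fst (Var 1)) (Var 2)))) (Assign 1 (Snd (Var 1)))"
  assumes "\<And>x acc. x \<in> set xs \<Longrightarrow> sz acc \<le> B \<Longrightarrow> runs_within orc c (enc (e, x, acc)) (enc (G x acc)) K"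
    and "\<And>x acc. x \<in> set xs \<Longrightarrow> sz (G x acc) \<le> sz acc + Q"
    and "sz acc + length xs * Q \<le> B"
    and "s 0 = enc e" "s 1 = enc xs" "s 2 = enc acc"
  shows "exec_within orc (While (Var 1) (body c)) s (2 + length xs * (K + 12))
     (s(1 := Tip, 2 := enc (fold G xs acc)))"
  using assms(2-)
proof (induction xs arbitrary: acc s)
  case Nil
  have "s(1 := Tip, 2 := enc (fold G [] acc)) = s" using Nil by auto
  moreover have "exec_within orc (While (Var 1) (body c)) s (1 + expr_cost (Var 1)) s"
    by (rule exec_within_While_Tip) (use Nil in simp)
  ultimately show ?case by (metis add_0_right expr_cost.simps(1) list.size(3) mult_0 one_add_one)
next
  case (Cons x xs)
  let ?s = "s(2 := enc (G x acc), 1 := enc xs)"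
  have acc: "sz acc \<le> B" "sz (G x acc) + length xs * Q \<le> B"
    using Cons.prems(2)[of x acc] Cons.prems(3) by auto
  have "exec_within orc (Call 2 c (Pair (Var 0) (Pair (Fst (Var 1)) (Var 2)))) s (7 + K)
      (s(2 := enc (G x acc)))"
    by (rule exec_within_Call[OF _ Cons.prems(1)]) (use acc Cons.prems(4-) in auto)
  from exec_within_Seq[OF this exec_within_Assign[of orc 1 "Snd (Var 1)"]]
  have 1: "exec_within orc (body c) s (10 + K) ?s"
    using Cons.prems(5) by (simp add: body_def)
  have 2: "exec_within orc (While (Var 1) (body c)) ?s (2 + length xs * (K + 12))
     (?s(1 := Tip, 2 := enc (fold G xs (G x acc))))"
    using Cons.prems acc by (intro Cons.IH) auto
  have eq: "?s(1 := Tip, 2 := enc (fold G xs (G x acc))) = s(1 := Tip, 2 := enc (fold G (x # xs) acc))"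
    by (auto simp: fun_eq_iff)
  have "exec_within orc (While (Var 1) (body c)) s
      (1 + expr_cost (Var 1) + (10 + K) + (2 + length xs * (K + 12)))
      (s(1 := Tip, 2 := enc (fold G (x # xs) acc)))"
    using exec_within_While[OF _ 1 2] Cons.prems(5) unfolding eq by simp
  then show ?case by (rule exec_within_mono) simp
qed

text \<open>
  Without the bound on the growth of the accumulator, iterated doubling would be in the class.
\<close>

lemma ptime_fold:
  fixes L :: "'a::encodable \<Rightarrow> 'b::encodable list" and I :: "'a \<Rightarrow> 'c::encodable"
  assumes L: "ptime L" and I: "ptime I"
    and G: "ptime (\<lambda>z. G (fst z) (fst (snd z)) (snd (snd z)))"
    and grow: "\<And>e x acc. sz (G e x acc) \<le> sz acc + poly q (sz e + sz x)"
  shows "ptime (\<lambda>e. fold (G e) (L e) (I e))"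
proof -
  obtain cL pL cI pI cG pG where L: "computes cL L pL" and I: "computes cI I pI"
    and G: "computes cG (\<lambda>z. G (fst z) (fst (snd z)) (snd (snd z))) pG"
    using assms(1-3) by (elim ptimeE)
  \<comment> \<open>In terms of the size of the environment, \<open>pQ\<close> bounds the growth per
    element, \<open>pB\<close> the accumulator at any time, and \<open>pK\<close> the cost of one
    step on a triple.\<close>
  define pQ where "pQ = pcompose q ([:0, 1:] + pL)"
  define pB where "pB = pI + pL * pQ"
  define pK where "pK = pcompose pG ([:2, 1:] + pL + pB)"
  let ?r = "[:12:] + pL + pI + pL * (pK + [:12:]) + pB"
  have grow': "sz (G e x acc) \<le> sz acc + poly pQ (sz e)" if "x \<in> set (L e)" for e x acc
  proof -
    have "sz x \<le> poly pL (sz e)"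
      using sz_elem[OF that] computes_sz[OF L order_refl, of e] by simp
    then have "poly q (sz e + sz x) \<le> poly pQ (sz e)"
      unfolding pQ_def poly_pcompose by (intro poly_mono_nat) simp
    then show ?thesis using grow[of e x acc] by simp
  qed
  have len: "length (L e) \<le> poly pL (sz e)" for e
    using length_le_sz[of "L e"] computes_sz[OF L order_refl, of e] by simp
  have B: "sz (I e) + length (L e) * poly pQ (sz e) \<le> poly pB (sz e)" for e
    unfolding pB_def using computes_sz[OF I order_refl, of e] len[of e]
    by (auto intro: add_mono mult_mono)
  show ?thesis
  proof (rule ptimeI)
    fix e :: 'a
    have "sz (fold (G e) (L e) (I e)) \<le> sz (I e) + length (L e) * poly pQ (sz e)"
      by (rule sz_fold_le) (rule grow')
    also have "\<dots> \<le> poly ?r (sz e)" using B[of e] by simp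
    finally show "sz (fold (G e) (L e) (I e)) \<le> poly ?r (sz e)" .
    fix orc
    let ?s0 = "start_store (enc e)"
    let ?s1 = "?s0(1 := enc (L e))"
    let ?s2 = "?s1(2 := enc (I e))"
    have 1: "exec_within orc (Call 1 cL (Var 0)) ?s0 (1 + 1 + poly pL (sz e)) ?s1"
      by (rule exec_within_Call[OF _ computes_run[OF L order_refl]]) (auto simp: start_store_def)
    have 2: "exec_within orc (Call 2 cI (Var 0)) ?s1 (1 + 1 + poly pI (sz e)) ?s2"
      by (rule exec_within_Call[OF _ computes_run[OF I order_refl]]) (auto simp: start_store_def)
    have 3: "runs_within orc cG (enc (e, x, acc)) (enc (G e x acc)) (poly pK (sz e))"
      if x: "x \<in> set (L e)" and acc: "sz acc \<le> poly pB (sz e)" for x acc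
    proof -
      have "sz (e, x, acc) \<le> poly ([:2, 1:] + pL + pB) (sz e)"
        using sz_elem[OF x] computes_sz[OF L order_refl, of e] acc by simp
      from computes_run[OF G this] show ?thesis by (simp add: pK_def poly_pcompose)
    qed
    note 4 = exec_within_fold[of "L e" "poly pB (sz e)" orc cG e "G e" "poly pK (sz e)" "poly pQ (sz e)"
        "I e" ?s2, OF 3 grow' B]
    have 5: "exec_within orc (While (Var 1)
        (Seq (Call 2 cG (Pair (Var 0) (Pair (Fst (Var 1)) (Var 2)))) (Assign 1 (Snd (Var 1)))))
        ?s2 (2 + length (L e) * (poly pK (sz e) + 12))
        (?s2(1 := Tip, 2 := enc (fold (G e) (L e) (I e))))"
      by (rule 4) (auto simp: start_store_def)
    have "length (L e) * (poly pK (sz e) + 12) \<le> poly pL (sz e) * (poly pK (sz e) + 12)"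
      using len by (rule mult_right_mono) simp
    then show "runs_within orc
      (Seq (Call 1 cL (Var 0)) (Seq (Call 2 cI (Var 0)) (Seq (While (Var 1)
        (Seq (Call 2 cG (Pair (Var 0) (Pair (Fst (Var 1)) (Var 2)))) (Assign 1 (Snd (Var 1)))))
        (Assign 0 (Var 2)))))
      (enc e) (enc (fold (G e) (L e) (I e))) (poly ?r (sz e))"
      by (intro runs_withinI[OF exec_within_mono[OF exec_within_Seq[OF 1
              exec_within_Seq[OF 2 exec_within_Seq[OF 5 exec_within_Assign]]]]])
        (auto simp: algebra_simps)
  qed
qed

section \<open>Derived closure properties: several arguments, control structures, lists, unary
  numbers\<close>

lemma ptime_comp2:
  assumes "ptime (\<lambda>z. f (fst z) (snd z))" "ptime a" "ptime b"
  shows "ptime (\<lambda>e. f (a e) (b e))"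
  using ptime_comp[OF assms(1) ptime_pair[OF assms(2,3)]] by simp

lemma ptime_comp3:
  assumes "ptime (\<lambda>z. f (fst z) (fst (snd z)) (snd (snd z)))" "ptime a" "ptime b" "ptime c"
  shows "ptime (\<lambda>e. f (a e) (b e) (c e))"
  using ptime_comp[OF assms(1) ptime_pair[OF assms(2) ptime_pair[OF assms(3,4)]]] by simp

lemma ptime_comp4:
  assumes "ptime (\<lambda>z. f (fst z) (fst (snd z)) (fst (snd (snd z))) (snd (snd (snd z))))"
    and "ptime a" "ptime b" "ptime c" "ptime d"
  shows "ptime (\<lambda>e. f (a e) (b e) (c e) (d e))"
  using ptime_comp[OF assms(1) ptime_pair[OF assms(2) ptime_pair[OF assms(3) ptime_pair[OF assms(4,5)]]]]
  by simp

lemma ptime_Let [ptime_intros]: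
  assumes "ptime f" "ptime (\<lambda>z. g (fst z) (snd z))"
  shows "ptime (\<lambda>e. let x = f e in g e x)"
  unfolding Let_def by (rule ptime_comp2[OF assms(2) ptime_id assms(1)])

text \<open>\<open>True\<close> is encoded like \<open>[Tip]\<close> and \<open>False\<close> like
  \<open>[]\<close>, so a conditional is a case distinction on lists.\<close>

lemma ptime_If [ptime_intros]:
  assumes "ptime b" "ptime f" "ptime g"
  shows "ptime (\<lambda>e. if b e then f e else g e)"
proof -
  have "ptime (\<lambda>e. if b e then [Tip] else [])"
    by (rule ptime_recode[OF assms(1)]) (simp add: bool_tree_def)
  from ptime_case_list[OF this assms(3) ptime_comp[OF assms(2) ptime_fst[OF ptime_id]]]
  have "ptime (\<lambda>e. case (if b e then [Tip] else []) of [] \<Rightarrow> g e | x # xs \<Rightarrow> f e)" .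
  then show ?thesis by (rule ptime_recode) simp
qed

lemma ptime_Not [ptime_intros]: "ptime P \<Longrightarrow> ptime (\<lambda>e. \<not> P e)"
  by (rule ptime_recode[OF ptime_If[OF _ ptime_False ptime_True, of P]]) auto

lemma ptime_conj [ptime_intros]: "ptime P \<Longrightarrow> ptime Q \<Longrightarrow> ptime (\<lambda>e. P e \<and> Q e)"
  by (rule ptime_recode[OF ptime_If[OF _ _ ptime_False, of P Q]]) auto

lemma ptime_Nil_eq [ptime_intros]:
  assumes "ptime L"
  shows "ptime (\<lambda>e. L e = [])"
proof -
  have "ptime (\<lambda>e. case L e of [] \<Rightarrow> True | x # xs \<Rightarrow> False)"
    by (intro ptime_intros assms)
  then show ?thesis by (rule ptime_recode) (auto split: list.split)
qed

lemma ptime_tl [ptime_intros]: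
  assumes "ptime L"
  shows "ptime (\<lambda>e. tl (L e))"
proof -
  have "ptime (\<lambda>e. case L e of [] \<Rightarrow> [] | x # xs \<Rightarrow> xs)"
    by (intro ptime_intros assms)
  then show ?thesis by (rule ptime_recode) (auto split: list.split)
qed

lemma ptime_rev [ptime_intros]:
  assumes "ptime L"
  shows "ptime (\<lambda>e. rev (L e))"
proof -
  have "ptime (\<lambda>e. fold (\<lambda>x acc. x # acc) (L e) [])"
    by (rule ptime_fold[OF assms, of _ _ "[:1, 1:]"]) (auto intro!: ptime_intros)
  then show ?thesis by (rule ptime_recode) (simp add: fold_Cons_rev)
qed

lemma ptime_append [ptime_intros]:
  assumes "ptime f" "ptime g"
  shows "ptime (\<lambda>e. f e @ g e)"
proof -
  have "ptime (\<lambda>e. fold (\<lambda>x acc. x # acc) (rev (f e)) (g e))"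
    by (rule ptime_fold[OF ptime_rev[OF assms(1)] assms(2), of _ "[:1, 1:]"])
      (auto intro!: ptime_intros)
  then show ?thesis by (rule ptime_recode) (simp add: fold_Cons_rev)
qed

lemma ptime_concat_map [ptime_intros]:
  fixes L :: "'a::encodable \<Rightarrow> 'b::encodable list" and g :: "'a \<Rightarrow> 'b \<Rightarrow> 'c::encodable list"
  assumes "ptime L" "ptime (\<lambda>z. g (fst z) (snd z))"
  shows "ptime (\<lambda>e. concat (map (\<lambda>x. g e x) (L e)))"
proof -
  obtain c p where g: "computes c (\<lambda>z. g (fst z) (snd z)) p"
    using assms(2) by (rule ptimeE)
  have "ptime (\<lambda>e. fold (\<lambda>x acc. acc @ g e x) (L e) [])"
  proof (rule ptime_fold[OF assms(1) ptime_Nil, of _ "pcompose p [:1, 1:]"])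
    show "ptime (\<lambda>z. snd (snd z) @ g (fst z) (fst (snd z)))"
      by (intro ptime_intros ptime_comp2[OF assms(2)])
    fix e x acc
    show "sz (acc @ g e x) \<le> sz acc + poly (pcompose p [:1, 1:]) (sz e + sz x)"
      using sz_append[of acc "g e x"] computes_sz[OF g order_refl, of "(e, x)"]
      by (simp add: poly_pcompose)
  qed
  moreover have "fold (\<lambda>x acc. acc @ h x) xs ys = ys @ concat (map h xs)" for h :: "'b \<Rightarrow> 'c list" and xs ys
    by (induction xs arbitrary: ys) auto
  ultimately show ?thesis by (auto intro: ptime_recode)
qed

lemma ptime_map [ptime_intros]:
  assumes "ptime L" "ptime (\<lambda>z. g (fst z) (snd z))"
  shows "ptime (\<lambda>e. map (\<lambda>x. g e x) (L e))"
proof -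
  have "ptime (\<lambda>e. concat (map (\<lambda>x. [g e x]) (L e)))"
    by (intro ptime_intros assms)
  then show ?thesis by simp
qed

lemma ptime_filter [ptime_intros]:
  fixes L :: "'a::encodable \<Rightarrow> 'b::encodable list"
  assumes "ptime L" "ptime (\<lambda>z. P (fst z) (snd z))"
  shows "ptime (\<lambda>e. filter (\<lambda>x. P e x) (L e))"
proof -
  have "ptime (\<lambda>e. concat (map (\<lambda>x. if P e x then [x] else []) (L e)))"
    by (intro ptime_intros assms)
  moreover have "concat (map (\<lambda>x. if Q x then [x] else []) xs) = filter Q xs"
    for Q :: "'b \<Rightarrow> bool" and xs
    by (induction xs) auto
  ultimately show ?thesis by simp
qed

lemma ptime_Bex [ptime_intros]:
  assumes "ptime L" "ptime (\<lambda>z. P (fst z) (snd z))"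
  shows "ptime (\<lambda>e. \<exists>x\<in>set (L e). P e x)"
proof -
  have "ptime (\<lambda>e. \<not> filter (\<lambda>x. P e x) (L e) = [])"
    by (intro ptime_intros assms)
  then show ?thesis by (simp add: filter_empty_conv)
qed

lemma ptime_Ball [ptime_intros]:
  assumes "ptime L" "ptime (\<lambda>z. P (fst z) (snd z))"
  shows "ptime (\<lambda>e. \<forall>x\<in>set (L e). P e x)"
proof -
  have "ptime (\<lambda>e. filter (\<lambda>x. \<not> P e x) (L e) = [])"
    by (intro ptime_intros assms)
  then show ?thesis by (simp add: filter_empty_conv)
qed

lemma ptime_length [ptime_intros]:
  fixes L :: "'a::encodable \<Rightarrow> 'b::encodable list"
  assumes "ptime L"
  shows "ptime (\<lambda>e. length (L e))"
proof -
  have "ptime (\<lambda>e. fold (\<lambda>x acc. Suc acc) (L e) 0)"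
    by (rule ptime_fold[OF assms ptime_zero, of _ "[:2:]"]) (auto intro!: ptime_intros)
  moreover have "fold (\<lambda>x. Suc) xs n = n + length xs" for xs :: "'b list" and n
    by (induction xs arbitrary: n) auto
  ultimately show ?thesis by simp
qed

text \<open>Dropping \<open>g e\<close> cells from a list of \<open>f e\<close> cells leaves nothing
  iff \<open>f e \<le> g e\<close>; as \<open>tl\<close> only shrinks, the growth bound of the fold
  is 0.\<close>

lemma ptime_nat_le [ptime_intros]:
  assumes "ptime f" "ptime g"
  shows "ptime (\<lambda>e. f e \<le> (g e :: nat))"
proof -
  have enc: "enc (replicate n Tip) = enc n" for n
    by (induction n) auto
  have "ptime (\<lambda>e. fold (\<lambda>x acc. tl acc) (replicate (g e) Tip) (replicate (f e) Tip) = [])"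
  proof (rule ptime_Nil_eq[OF ptime_fold])
    show "ptime (\<lambda>e. replicate (g e) Tip)" "ptime (\<lambda>e. replicate (f e) Tip)"
      by (rule ptime_recode[OF assms(2)] ptime_recode[OF assms(1)], rule enc)+
    show "sz (tl xs) \<le> sz xs + poly 0 (sz e + sz x)" for e :: 'a and x and xs :: "tree list"
      by (cases xs) auto
  qed (intro ptime_intros)
  moreover have "fold (\<lambda>x acc. tl acc) (replicate n Tip) (replicate m Tip) = [] \<longleftrightarrow> m \<le> n" for m n
  proof (induction n arbitrary: m)
    case (Suc n)
    show ?case using Suc[of 0] Suc[of "m - 1"] by (cases m) (auto simp: fold_replicate)
  qed simp
  ultimately show ?thesis by simp
qed

lemma ptime_nat_eq [ptime_intros]:
  assumes "ptime f" "ptime g"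
  shows "ptime (\<lambda>e. f e = (g e :: nat))"
proof -
  have "ptime (\<lambda>e. f e \<le> g e \<and> g e \<le> f e)"
    by (intro ptime_intros assms)
  then show ?thesis by (simp add: eq_iff)
qed

text \<open>On a sorted list this is ordinary insertion; phrased with filters, it falls directly
  under the closure rules above.\<close>

definition insert_by :: "('a \<Rightarrow> nat) \<Rightarrow> 'a \<Rightarrow> 'a list \<Rightarrow> 'a list" where
  "insert_by k x ys = [y\<leftarrow>ys. k y \<le> k x] @ x # [y\<leftarrow>ys. \<not> k y \<le> k x]"

definition order_by :: "('a \<Rightarrow> nat) \<Rightarrow> 'a list \<Rightarrow> 'a list" where
  "order_by k xs = fold (insert_by k) xs []"

text \<open>Appending keeps the chosen elements in the order of \<open>vs\<close>. If
  \<open>vs\<close> is sorted by a key, the first chosen neighbour of an element is thus one of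
  least key.\<close>

definition greedy :: "('a \<Rightarrow> 'a \<Rightarrow> bool) \<Rightarrow> 'a list \<Rightarrow> 'a list" where
  "greedy adj vs = fold (\<lambda>v ws. if \<exists>w\<in>set ws. adj v w then ws else ws @ [v]) vs []"

lemma sz_insert_by: "sz (insert_by k x ys) = sz ys + sz x + 1"
proof -
  have "sz [y\<leftarrow>ys. P y] + sz [y\<leftarrow>ys. \<not> P y] = sz ys + 1" for P
    by (induction ys) auto
  from this[of "\<lambda>y. k y \<le> k x"] show ?thesis
    using sz_append[of "[y\<leftarrow>ys. k y \<le> k x]" "x # [y\<leftarrow>ys. \<not> k y \<le> k x]"]
    unfolding insert_by_def by simp
qed

lemma ptime_order_by [ptime_intros]:
  assumes "ptime (\<lambda>z. k (fst z) (snd z))" "ptime L"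
  shows "ptime (\<lambda>e. order_by (\<lambda>x. k e x) (L e))"
  unfolding order_by_def
proof (rule ptime_fold[OF assms(2) ptime_Nil])
  show "ptime (\<lambda>z. insert_by (k (fst z)) (fst (snd z)) (snd (snd z)))"
    unfolding insert_by_def by (intro ptime_intros ptime_comp2[OF assms(1)])
  show "sz (insert_by (k e) x acc) \<le> sz acc + poly [:1, 1:] (sz e + sz x)" for e x acc
    by (simp add: sz_insert_by)
qed

lemma ptime_greedy [ptime_intros]:
  assumes "ptime (\<lambda>z. adj (fst z) (fst (snd z)) (snd (snd z)))" "ptime L"
  shows "ptime (\<lambda>e. greedy (\<lambda>x y. adj e x y) (L e))"
  unfolding greedy_def
proof (rule ptime_fold[OF assms(2) ptime_Nil])
  show "ptime (\<lambda>z. if \<exists>w\<in>set (snd (snd z)). adj (fst z) (fst (snd z)) w then snd (snd z)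
      else snd (snd z) @ [fst (snd z)])"
    by (intro ptime_intros ptime_comp3[OF assms(1)])
  show "sz (if \<exists>w\<in>set ws. adj e v w then ws else ws @ [v]) \<le> sz ws + poly [:1, 1:] (sz e + sz v)"
    for e v ws
    using sz_append[of ws "[v]"] by simp
qed


section \<open>The algorithm\<close>

text \<open>
  The last two components are the description of the family and the end of the input list.
\<close>

type_synonym input =
  "nat list \<times> nat list \<times> ((nat \<times> nat) \<times> real) list \<times> nat \<times> tree \<times> tree"

text \<open>
  The guesses still to be tried, the input, the pairs of a guess and a centre to which some customer
  was sent in a round for that guess, and the solutions found so far with their guesses, the best
  one first.
\<close>

type_synonym state =
  "real list \<times> input \<times> (real \<times> nat) list \<times> (real \<times> nat list \<times> nat list) list"

abbreviation in_facs :: "input \<Rightarrow> nat list" where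
  "in_facs a \<equiv> fst a"
abbreviation in_custs :: "input \<Rightarrow> nat list" where
  "in_custs a \<equiv> fst (snd a)"
abbreviation in_dist :: "input \<Rightarrow> ((nat \<times> nat) \<times> real) list" where
  "in_dist a \<equiv> fst (snd (snd a))"
abbreviation in_demand :: "input \<Rightarrow> nat" where
  "in_demand a \<equiv> fst (snd (snd (snd a)))"
abbreviation in_desc :: "input \<Rightarrow> tree" where
  "in_desc a \<equiv> fst (snd (snd (snd (snd a))))"

definition near :: "input \<Rightarrow> real \<Rightarrow> nat \<Rightarrow> nat \<Rightarrow> bool" where
  "near a r u f \<longleftrightarrow> (\<exists>e\<in>set (in_dist a). fst (fst e) = u \<and> snd (fst e) = f \<and> snd e \<le> r)"

definition coverable :: "input \<Rightarrow> real \<Rightarrow> nat list" where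
  "coverable a r = [u\<leftarrow>in_custs a. \<exists>f\<in>set (in_facs a). near a r u f]"

text \<open>Replaces the condition that \<open>u\<close> and \<open>v\<close> be within
  \<open>2 * r\<close>, which would require real arithmetic. It implies that condition, and its
  negation says precisely that no facility is near both, so unlinked centres have disjoint
  neighbourhoods.\<close>

definition linked :: "input \<Rightarrow> real \<Rightarrow> nat \<Rightarrow> nat \<Rightarrow> bool" where
  "linked a r u v \<longleftrightarrow> (\<exists>f\<in>set (in_facs a). near a r u f \<and> near a r v f)"

text \<open>The perceptron entry of \<open>v\<close> is the number of rounds minus the occurrences
  of \<open>v\<close> in the history \<open>h\<close>. Largest entry first therefore means fewest
  occurrences first, which avoids signed numbers.\<close>

definition centres :: "input \<Rightarrow> real \<Rightarrow> nat list \<Rightarrow> nat list" where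
  "centres a r h =
     greedy (\<lambda>u v. linked a r u v) (order_by (\<lambda>v. length [w\<leftarrow>h. w = v]) (coverable a r))"

definition centre :: "input \<Rightarrow> real \<Rightarrow> nat list \<Rightarrow> nat \<Rightarrow> nat" where
  "centre a r h u = (case [w\<leftarrow>centres a r h. linked a r u w] of [] \<Rightarrow> 0 | w # ws \<Rightarrow> w)"

text \<open>Testing at the centre instead of at \<open>u\<close> costs a detour of
  \<open>2 * r\<close> in the guarantee, but turns the count into an F-PCM value.\<close>

definition served :: "input \<Rightarrow> real \<Rightarrow> nat list \<Rightarrow> nat list \<Rightarrow> nat list" where
  "served a r h S = [u\<leftarrow>coverable a r. \<exists>f\<in>set S. near a r (centre a r h u) f]"

text \<open>
  At most one centre is near a given facility, so the value below is the size of its cluster, and 0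
  for a facility that is near no centre.
\<close>

definition query ::
  "input \<Rightarrow> real \<Rightarrow> nat list \<Rightarrow> nat list \<times> tree \<times> nat list list \<times> (nat \<times> nat) list list" where
  "query a r h = (in_facs a, in_desc a,
     map (\<lambda>w. [f\<leftarrow>in_facs a. near a r w f]) (centres a r h),
     [map (\<lambda>f. (f, length (served a r h [f]))) (in_facs a)])"

text \<open>Equality of reals is decided by two comparisons. Since the history is keyed by the value
  of the guess, equal distances in the table continue one and the same perceptron run.\<close>

definition visits :: "(real \<times> nat) list \<Rightarrow> real \<Rightarrow> nat list" where
  "visits H r = map (\<lambda>e. snd e) [e\<leftarrow>H. fst e \<le> r \<and> r \<le> fst e]"

text \<open>
  Every guess is tried more often than there can be failed rounds for a correct guess.
\<close>

definition init_state :: "input \<Rightarrow> state" where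
  "init_state a =
     (concat (map (\<lambda>e. concat (map (\<lambda>i. concat (map (\<lambda>j. map (\<lambda>k. snd e)
        (0 # in_custs a)) (0 # in_custs a))) (0 # in_custs a))) (in_dist a)), a, [], [])"

definition state_query ::
  "state \<Rightarrow> nat list \<times> tree \<times> nat list list \<times> (nat \<times> nat) list list" where
  "state_query st = (case fst st of [] \<Rightarrow> ([], Tip, [], [])
     | r # rs \<Rightarrow> query (fst (snd st)) r (visits (fst (snd (snd st))) r))"

text \<open>The history grows after a success too; from then on some recorded solution has a guess
  of at most \<open>r\<close>. Recording only guesses not above any earlier one keeps
  \<open>best\<close> sorted.\<close>

definition step :: "state \<Rightarrow> nat list \<Rightarrow> state" where
  "step st S = (case fst st of [] \<Rightarrow> st | r # rs \<Rightarrow>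
     (let a = fst (snd st); H = fst (snd (snd st)); best = snd (snd (snd st));
          h = visits H r; U = served a r h S
      in (rs, a, map (\<lambda>u. (r, centre a r h u)) (coverable a r) @ H,
          if in_demand a \<le> length U \<and> (\<forall>b\<in>set best. r \<le> fst b) then (r, S, U) # best else best)))"

text \<open>If no guess succeeded although there are customers, then the optimum is infinite, and
  the empty set together with all customers is good enough.\<close>

definition result :: "state \<Rightarrow> nat list \<times> nat list" where
  "result st = (case snd (snd (snd st)) of [] \<Rightarrow> ([], in_custs (fst (snd st))) | b # bs \<Rightarrow> snd b)"

section \<open>Polynomial time of the functions of a round\<close>

lemma ptime_near: "ptime (\<lambda>z. near (fst z) (fst (snd z)) (fst (snd (snd z))) (snd (snd (snd z))))"
  unfolding near_def by (intro ptime_intros)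

lemmas [ptime_intros] = ptime_comp4[OF ptime_near]

lemma ptime_coverable: "ptime (\<lambda>z. coverable (fst z) (snd z))"
  unfolding coverable_def by (intro ptime_intros)

lemmas [ptime_intros] = ptime_comp2[OF ptime_coverable]

lemma ptime_linked: "ptime (\<lambda>z. linked (fst z) (fst (snd z)) (fst (snd (snd z))) (snd (snd (snd z))))"
  unfolding linked_def by (intro ptime_intros)

lemmas [ptime_intros] = ptime_comp4[OF ptime_linked]

lemma ptime_centres: "ptime (\<lambda>z. centres (fst z) (fst (snd z)) (snd (snd z)))"
  unfolding centres_def by (intro ptime_intros)

lemmas [ptime_intros] = ptime_comp3[OF ptime_centres]

lemma ptime_centre: "ptime (\<lambda>z. centre (fst z) (fst (snd z)) (fst (snd (snd z))) (snd (snd (snd z))))"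
  unfolding centre_def by (intro ptime_intros)

lemmas [ptime_intros] = ptime_comp4[OF ptime_centre]

lemma ptime_served: "ptime (\<lambda>z. served (fst z) (fst (snd z)) (fst (snd (snd z))) (snd (snd (snd z))))"
  unfolding served_def by (intro ptime_intros)

lemmas [ptime_intros] = ptime_comp4[OF ptime_served]

lemma ptime_query: "ptime (\<lambda>z. query (fst z) (fst (snd z)) (snd (snd z)))"
  unfolding query_def by (intro ptime_intros)

lemmas [ptime_intros] = ptime_comp3[OF ptime_query]

lemma ptime_visits: "ptime (\<lambda>z. visits (fst z) (snd z))"
  unfolding visits_def by (intro ptime_intros)

lemmas [ptime_intros] = ptime_comp2[OF ptime_visits]

lemma ptime_init_state: "ptime init_state"
  unfolding init_state_def[abs_def] by (intro ptime_intros)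

lemma ptime_state_query: "ptime state_query"
  unfolding state_query_def[abs_def] by (intro ptime_intros)

lemma ptime_step: "ptime (\<lambda>z. step (fst z) (snd z))"
  unfolding step_def by (intro ptime_intros)

lemma ptime_result: "ptime result"
  unfolding result_def[abs_def] by (intro ptime_intros)

section \<open>Greedy selection of centres\<close>

lemma insert_by_sorted:
  "sorted_wrt (\<lambda>x y. k x \<le> k y) ys \<Longrightarrow> sorted_wrt (\<lambda>x y. k x \<le> k y) (insert_by k x ys)"
  unfolding insert_by_def by (auto simp: sorted_wrt_append sorted_wrt_filter)

lemma set_insert_by: "set (insert_by k x ys) = insert x (set ys)"
  unfolding insert_by_def by auto

lemma fold_insert_by:
  "set (fold (insert_by k) xs ys) = set xs \<union> set ys"
  "sorted_wrt (\<lambda>x y. k x \<le> k y) ys \<Longrightarrow> sorted_wrt (\<lambda>x y. k x \<le> k y) (fold (insert_by k) xs ys)"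
  by (induction xs arbitrary: ys) (auto simp: set_insert_by insert_by_sorted)

lemma set_order_by [simp]: "set (order_by k xs) = set xs"
  unfolding order_by_def by (simp add: fold_insert_by)

lemma sorted_order_by: "sorted_wrt (\<lambda>x y. k x \<le> k y) (order_by k xs)"
  unfolding order_by_def by (simp add: fold_insert_by)

text \<open>\<open>greedy\<close> is a left fold, hence the reverse induction. A rejected
  \<open>v\<close> is dominated by the neighbour that caused the rejection, which came earlier and
  so has no larger key; a chosen \<open>v\<close> is dominated by itself.\<close>

lemma greedy_props:
  fixes k :: "'a \<Rightarrow> nat"
  assumes "sorted_wrt (\<lambda>x y. k x \<le> k y) vs" "\<And>v. v \<in> set vs \<Longrightarrow> adj v v"
  shows "set (greedy adj vs) \<subseteq> set vs \<and> distinct (greedy adj vs) \<and>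
    sorted_wrt (\<lambda>x y. k x \<le> k y) (greedy adj vs) \<and>
    sorted_wrt (\<lambda>x y. \<not> adj y x) (greedy adj vs) \<and>
    (\<forall>u\<in>set vs. \<exists>w\<in>set (greedy adj vs). adj u w \<and> k w \<le> k u)"
  using assms
proof (induction vs rule: rev_induct)
  case Nil
  then show ?case by (simp add: greedy_def)
next
  case (snoc v vs)
  have eq: "greedy adj (vs @ [v]) = (if \<exists>w\<in>set (greedy adj vs). adj v w then greedy adj vs
      else greedy adj vs @ [v])"
    unfolding greedy_def by simp
  have "sorted_wrt (\<lambda>x y. k x \<le> k y) vs" and "\<And>v. v \<in> set vs \<Longrightarrow> adj v v"
    using snoc.prems by (auto simp: sorted_wrt_append)
  from snoc.IH[OF this] have IH: "set (greedy adj vs) \<subseteq> set vs" "distinct (greedy adj vs)"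
    "sorted_wrt (\<lambda>x y. k x \<le> k y) (greedy adj vs)" "sorted_wrt (\<lambda>x y. \<not> adj y x) (greedy adj vs)"
    "\<forall>u\<in>set vs. \<exists>w\<in>set (greedy adj vs). adj u w \<and> k w \<le> k u"
    by blast+
  have le: "k w \<le> k v" if "w \<in> set (greedy adj vs)" for w
    using that IH(1) snoc.prems(1) by (auto simp: sorted_wrt_append)
  show ?case
  proof (cases "\<exists>w\<in>set (greedy adj vs). adj v w")
    case True
    then obtain w where "w \<in> set (greedy adj vs)" "adj v w" by blast
    then have "\<forall>u\<in>set (vs @ [v]). \<exists>w\<in>set (greedy adj vs). adj u w \<and> k w \<le> k u"
      using IH(5) le by auto
    moreover have "greedy adj (vs @ [v]) = greedy adj vs" by (subst eq) (simp only: True if_True)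
    ultimately show ?thesis using IH(1-4) by auto
  next
    case False
    have "adj v v" using snoc.prems(2) by simp
    then have "v \<notin> set (greedy adj vs)" using False by blast
    moreover have "greedy adj (vs @ [v]) = greedy adj vs @ [v]" by (subst eq) (simp only: False if_False)
    moreover have "\<forall>u\<in>set (vs @ [v]). \<exists>w\<in>set (greedy adj vs @ [v]). adj u w \<and> k w \<le> k u"
      using IH(5) \<open>adj v v\<close> by auto
    ultimately show ?thesis using False IH(1-4) le by (auto simp: sorted_wrt_append)
  qed
qed

section \<open>The perceptron\<close>

text \<open>Let \<open>a v\<close> be the size of the fibre over \<open>v\<close> and expand the
  square of \<open>y + (1 - a)\<close>. The cross term is nonpositive: the sum of
  \<open>y v * a v\<close> equals that of \<open>y (c u)\<close>, which is at least that of
  \<open>y u\<close>. The entries of \<open>a\<close> sum to \<open>card V\<close> and none exceeds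
  it, which bounds the last square.\<close>

lemma perceptron_norm:
  fixes y :: "'a \<Rightarrow> int"
  assumes "finite V" "c ` V \<subseteq> V" "\<And>u. u \<in> V \<Longrightarrow> y u \<le> y (c u)"
  shows "(\<Sum>v\<in>V. (y v + 1 - int (card {u\<in>V. c u = v}))\<^sup>2) \<le> (\<Sum>v\<in>V. (y v)\<^sup>2) + (int (card V))\<^sup>2"
proof -
  define a where "a v = int (card {u\<in>V. c u = v})" for v
  have a0: "0 \<le> a v" and an: "a v \<le> int (card V)" for v
    unfolding a_def using assms(1) by (auto intro: card_mono)
  have sum_a: "(\<Sum>v\<in>V. a v) = int (card V)"
    using sum.group[OF assms(1,1,2), of "\<lambda>_. 1 :: int"] unfolding a_def by simp
  have ya: "(\<Sum>v\<in>V. y v * a v) = (\<Sum>u\<in>V. y (c u))"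
  proof -
    have "(\<Sum>v\<in>V. y v * a v) = (\<Sum>v\<in>V. \<Sum>u\<in>{u\<in>V. c u = v}. y (c u))"
    proof (intro sum.cong refl)
      fix v
      have "(\<Sum>u\<in>{u\<in>V. c u = v}. y (c u)) = (\<Sum>u\<in>{u\<in>V. c u = v}. y v)"
        by (rule sum.cong) auto
      then show "y v * a v = (\<Sum>u\<in>{u\<in>V. c u = v}. y (c u))"
        unfolding a_def by (simp add: mult.commute)
    qed
    also have "\<dots> = (\<Sum>u\<in>V. y (c u))"
      by (rule sum.group[OF assms(1,1,2)])
    finally show ?thesis .
  qed
  have 1: "(\<Sum>v\<in>V. y v * (1 - a v)) \<le> 0"
    using sum_mono[OF assms(3), of V] ya by (simp add: right_diff_distrib sum_subtractf)
  have "(\<Sum>v\<in>V. (1 - a v)\<^sup>2) = (\<Sum>v\<in>V. a v * a v) - int (card V)"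
    using sum_a by (simp add: power2_eq_square algebra_simps sum.distrib sum_subtractf
        flip: sum_distrib_right)
  also have "\<dots> \<le> (\<Sum>v\<in>V. a v * int (card V))"
    using sum_mono[of V "\<lambda>v. a v * a v" "\<lambda>v. a v * int (card V)"] a0 an
    by (simp add: mult_left_mono)
  also have "\<dots> = (int (card V))\<^sup>2"
    using sum_a by (simp add: power2_eq_square flip: sum_distrib_right)
  finally have 2: "(\<Sum>v\<in>V. (1 - a v)\<^sup>2) \<le> (int (card V))\<^sup>2" .
  have "(\<Sum>v\<in>V. (y v + 1 - a v)\<^sup>2)
      = (\<Sum>v\<in>V. (y v)\<^sup>2) + 2 * (\<Sum>v\<in>V. y v * (1 - a v)) + (\<Sum>v\<in>V. (1 - a v)\<^sup>2)"
  proof -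
    have "(y v + 1 - a v)\<^sup>2 = (y v)\<^sup>2 + 2 * (y v * (1 - a v)) + (1 - a v)\<^sup>2" for v
      by (simp add: power2_eq_square algebra_simps)
    then show ?thesis by (simp only: sum.distrib sum_distrib_left)
  qed
  then show ?thesis using 1 2 unfolding a_def by simp
qed

text \<open>With n = \<open>card V\<close>, \<open>t^2\<close> is at most the squared sum over
  \<open>X\<close>, so at most n times the squared norm, so at most \<open>t * n^3\<close>; then
  divide by \<open>t\<close>.\<close>

lemma perceptron_bound:
  fixes y :: "'a \<Rightarrow> int"
  assumes V: "finite V" "X \<subseteq> V"
    and norm: "(\<Sum>v\<in>V. (y v)\<^sup>2) \<le> int t * (int (card V))\<^sup>2"
    and prog: "int t \<le> (\<Sum>v\<in>X. y v)"
  shows "t \<le> card V ^ 3"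
proof (cases "t = 0")
  case False
  have "(int t)\<^sup>2 \<le> (\<Sum>v\<in>X. y v)\<^sup>2"
    using prog by (rule power_mono) (rule of_nat_0_le_iff)
  also have "\<dots> \<le> (\<Sum>v\<in>X. (y v)\<^sup>2) * int (card X)"
  proof -
    have "(\<Sum>v\<in>X. real_of_int (y v) * 1)\<^sup>2 \<le> (\<Sum>v\<in>X. (real_of_int (y v))\<^sup>2) * (\<Sum>v\<in>X. 1\<^sup>2)"
      by (rule Cauchy_Schwarz_ineq_sum)
    then have "real_of_int ((\<Sum>v\<in>X. y v)\<^sup>2) \<le> real_of_int ((\<Sum>v\<in>X. (y v)\<^sup>2) * int (card X))"
      by (simp only: of_int_power of_int_sum of_int_mult of_int_of_nat_eq mult_1_right power_one
          sum_constant)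
    then show ?thesis by (simp only: of_int_le_iff)
  qed
  also have "\<dots> \<le> (\<Sum>v\<in>V. (y v)\<^sup>2) * int (card V)"
  proof (rule mult_mono)
    show "(\<Sum>v\<in>X. (y v)\<^sup>2) \<le> (\<Sum>v\<in>V. (y v)\<^sup>2)"
      by (rule sum_mono2[OF V]) simp
    show "int (card X) \<le> int (card V)"
      using card_mono[OF V] by simp
  qed (simp_all add: sum_nonneg)
  also have "\<dots> \<le> int t * (int (card V))\<^sup>2 * int (card V)"
    using norm by (rule mult_right_mono) simp
  also have "\<dots> = int t * int (card V ^ 3)"
    by (simp only: of_nat_mult power2_eq_square power3_eq_cube mult.assoc)
  finally have "int t * int t \<le> int t * int (card V ^ 3)"
    unfolding power2_eq_square[of "int t"] .
  then have "int t \<le> int (card V ^ 3)"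
    by (rule mult_left_le_imp_le) (use False in simp)
  then show ?thesis by (simp only: of_nat_le_iff)
qed simp

text \<open>
  After \<open>t\<close> rounds, a customer \<open>v\<close> has weight \<open>t\<close> minus the number of customers sent to \<open>v\<close> in
  all rounds together.
\<close>

abbreviation occurrences :: "nat list \<Rightarrow> nat \<Rightarrow> nat" where
  "occurrences h v \<equiv> length [w\<leftarrow>h. w = v]"

text \<open>Upper bound on the norm and lower bound on the progress. The latter is kept for a whole
  family \<open>\<X>\<close>, as the run cannot know which cover is optimal.\<close>

definition potential :: "nat set \<Rightarrow> nat set set \<Rightarrow> nat \<Rightarrow> nat list \<Rightarrow> bool" where
  "potential V \<X> t h \<longleftrightarrow>
     (\<Sum>v\<in>V. (int t - int (occurrences h v))\<^sup>2) \<le> int t * (int (card V))\<^sup>2 \<and>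
     (\<forall>X\<in>\<X>. int t \<le> (\<Sum>v\<in>X. int t - int (occurrences h v)))"

lemma potential_zero: "potential V \<X> 0 []"
  unfolding potential_def by simp

lemma potential_bound:
  "finite V \<Longrightarrow> X \<in> \<X> \<Longrightarrow> X \<subseteq> V \<Longrightarrow> potential V \<X> t h \<Longrightarrow> t \<le> card V ^ 3"
  unfolding potential_def using perceptron_bound[of V X "\<lambda>v. int t - int (occurrences h v)" t] by blast

text \<open>A round adds 1 to each entry and subtracts the size of its fibre under \<open>c\<close>.
  Over \<open>X\<close> the gain is \<open>card X\<close> minus the number of elements sent into
  \<open>X\<close>, a positive integer and hence at least 1.\<close>

lemma potential_Suc:
  assumes "potential V \<X> t h" "distinct vs" "set vs = V" "c ` V \<subseteq> V"
    and "\<And>u. u \<in> V \<Longrightarrow> occurrences h (c u) \<le> occurrences h u"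
    and "\<And>X. X \<in> \<X> \<Longrightarrow> X \<subseteq> V \<and> card {u\<in>V. c u \<in> X} < card X"
  shows "potential V \<X> (Suc t) (map c vs @ h)"
proof -
  have fin: "finite V" using assms(3) by auto
  have occ: "occurrences (map c vs @ h) v = card {u\<in>V. c u = v} + occurrences h v" for v
  proof -
    have "{u\<in>V. c u = v} = set [u\<leftarrow>vs. c u = v]" using assms(3) by auto
    then have "card {u\<in>V. c u = v} = length [u\<leftarrow>vs. c u = v]"
      using assms(2) by (metis distinct_card distinct_filter)
    then show ?thesis by (simp add: filter_map comp_def)
  qed
  have eq: "int (Suc t) - int (occurrences (map c vs @ h) v) =
      (int t - int (occurrences h v)) + 1 - int (card {u\<in>V. c u = v})" for v
    unfolding occ by simp
  show ?thesis
    unfolding potential_def eq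
  proof (intro conjI ballI)
    have "(\<Sum>v\<in>V. (int t - int (occurrences h v) + 1 - int (card {u\<in>V. c u = v}))\<^sup>2)
        \<le> (\<Sum>v\<in>V. (int t - int (occurrences h v))\<^sup>2) + (int (card V))\<^sup>2"
      by (rule perceptron_norm[OF fin assms(4)]) (use assms(5) in force)
    also have "\<dots> \<le> int (Suc t) * (int (card V))\<^sup>2"
      using assms(1) unfolding potential_def by (simp add: algebra_simps)
    finally show "(\<Sum>v\<in>V. (int t - int (occurrences h v) + 1 - int (card {u\<in>V. c u = v}))\<^sup>2)
        \<le> int (Suc t) * (int (card V))\<^sup>2" .
  next
    fix X assume X: "X \<in> \<X>"
    then have X': "X \<subseteq> V" "finite X" "card {u\<in>V. c u \<in> X} < card X"
      using assms(6) fin by (auto intro: finite_subset)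
    have "(\<Sum>v\<in>X. card {u\<in>V. c u = v}) = card {u\<in>V. c u \<in> X}"
    proof -
      have "(\<Sum>v\<in>X. \<Sum>u\<in>{u \<in> {u\<in>V. c u \<in> X}. c u = v}. 1) = (\<Sum>u\<in>{u\<in>V. c u \<in> X}. 1 :: nat)"
        by (rule sum.group) (use fin X' in auto)
      moreover have "{u \<in> {u\<in>V. c u \<in> X}. c u = v} = {u\<in>V. c u = v}" if "v \<in> X" for v
        using that by auto
      ultimately show ?thesis by simp
    qed
    then have "(\<Sum>v\<in>X. int (card {u\<in>V. c u = v})) = int (card {u\<in>V. c u \<in> X})"
      by (simp flip: of_nat_sum)
    moreover have "int t \<le> (\<Sum>v\<in>X. int t - int (occurrences h v))"
      using assms(1) X unfolding potential_def by blast
    ultimately show "int (Suc t)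
        \<le> (\<Sum>v\<in>X. int t - int (occurrences h v) + 1 - int (card {u\<in>V. c u = v}))"
      using X'(3) by (simp add: sum.distrib sum_subtractf)
  qed
qed

section \<open>One round of the algorithm\<close>

text \<open>The distance table enters only as a set, because the encoder may list it in any order.
  The description of the family stays arbitrary: it is handed to the solver unread.\<close>

locale encoded_instance =
  fixes I :: supplier and a :: input
  assumes inst: "supplier_instance I"
    and facs: "distinct (in_facs a)" "set (in_facs a) = facs I"
    and custs: "distinct (in_custs a)" "set (in_custs a) = custs I"
    and dist: "set (in_dist a) =
      (\<lambda>(x, y). ((x, y), metr I x y)) ` ((facs I \<union> custs I) \<times> (facs I \<union> custs I))"
    and demand: "in_demand a = demand I"
begin

sublocale Metric_space "facs I \<union> custs I" "metr I"
  using inst unfolding supplier_instance_def by blast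

lemma finite_facs: "finite (facs I)" and finite_custs: "finite (custs I)"
  and fam_facs: "S \<in> fam I \<Longrightarrow> S \<subseteq> facs I" and fam_down: "S \<in> fam I \<Longrightarrow> S' \<subseteq> S \<Longrightarrow> S' \<in> fam I"
  and demand_le: "demand I \<le> card (custs I)"
  using inst unfolding supplier_instance_def down_closed_def by auto

lemma near_iff:
  "u \<in> facs I \<union> custs I \<Longrightarrow> f \<in> facs I \<union> custs I \<Longrightarrow> near a r u f \<longleftrightarrow> metr I u f \<le> r"
  unfolding near_def dist by force

lemma set_coverable: "set (coverable a r) = {u\<in>custs I. \<exists>f\<in>facs I. near a r u f}"
  unfolding coverable_def by (auto simp: facs custs)

lemma distinct_coverable: "distinct (coverable a r)"
  unfolding coverable_def by (simp add: custs)

lemma linkedI: "f \<in> facs I \<Longrightarrow> near a r u f \<Longrightarrow> near a r v f \<Longrightarrow> linked a r u v"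
  unfolding linked_def facs by blast

lemma linked_refl: "u \<in> set (coverable a r) \<Longrightarrow> linked a r u u"
  unfolding set_coverable by (auto intro: linkedI)

lemma centres_props:
  shows centres_coverable: "set (centres a r h) \<subseteq> set (coverable a r)"
    and distinct_centres: "distinct (centres a r h)"
    and sorted_centres: "sorted_wrt (\<lambda>u v. occurrences h u \<le> occurrences h v) (centres a r h)"
    and separated_centres: "sorted_wrt (\<lambda>u v. \<not> linked a r v u) (centres a r h)"
    and dominated: "u \<in> set (coverable a r) \<Longrightarrow>
      \<exists>w\<in>set (centres a r h). linked a r u w \<and> occurrences h w \<le> occurrences h u"
  using greedy_props[OF sorted_order_by[of "occurrences h" "coverable a r"], of "linked a r"]
    linked_refl
  unfolding centres_def by auto

text \<open>\<open>centre\<close> is the first linked element of a list sorted by occurrences, so it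
  occurs no more often than the dominating element \<open>w\<close> that the greedy selection
  guarantees.\<close>

lemma centre_props:
  assumes "u \<in> set (coverable a r)"
  shows centre_centres: "centre a r h u \<in> set (centres a r h)"
    and linked_centre: "linked a r u (centre a r h u)"
    and occurrences_centre: "occurrences h (centre a r h u) \<le> occurrences h u"
proof -
  obtain w where w: "w \<in> set [w\<leftarrow>centres a r h. linked a r u w]" "occurrences h w \<le> occurrences h u"
    using dominated[OF assms, of h] by auto
  then obtain v vs where vs: "[w\<leftarrow>centres a r h. linked a r u w] = v # vs"
    by (cases "[w\<leftarrow>centres a r h. linked a r u w]") auto
  then have v: "centre a r h u = v" unfolding centre_def by simp
  have "v \<in> set [w\<leftarrow>centres a r h. linked a r u w]" using vs by simp
  then show "centre a r h u \<in> set (centres a r h)" "linked a r u (centre a r h u)"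
    using v by simp_all
  have "sorted_wrt (\<lambda>u v. occurrences h u \<le> occurrences h v) (v # vs)"
    using sorted_wrt_filter[OF sorted_centres] vs by metis
  then have "occurrences h v \<le> occurrences h w" using w(1) unfolding vs by auto
  then show "occurrences h (centre a r h u) \<le> occurrences h u" using v w(2) by simp
qed

text \<open>A common near facility links the two centres, contradicting separation whichever of them
  was chosen first.\<close>

lemma centres_unique:
  assumes "w \<in> set (centres a r h)" "w' \<in> set (centres a r h)"
    and "f \<in> facs I" "near a r w f" "near a r w' f"
  shows "w = w'"
proof (rule ccontr)
  assume "w \<noteq> w'"
  moreover have "linked a r w w'" "linked a r w' w" using assms(3-) by (blast intro: linkedI)+
  moreover obtain i j where "i < length (centres a r h)" "j < length (centres a r h)"
    "w = centres a r h ! i" "w' = centres a r h ! j"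
    using assms(1,2) by (metis in_set_conv_nth)
  ultimately show False
    using separated_centres[of r h] unfolding sorted_wrt_iff_nth_less
    by (metis nat_neq_iff)
qed

lemma centre_eq:
  assumes "u \<in> set (coverable a r)" "w \<in> set (centres a r h)" "f \<in> facs I" "near a r w f"
  shows "near a r (centre a r h u) f \<longleftrightarrow> centre a r h u = w"
  using centres_unique[OF centre_centres[OF assms(1)] assms(2,3)] assms(4) by blast

lemma distinct_served: "distinct (served a r h S)"
  unfolding served_def by (simp add: distinct_coverable)

lemma set_served:
  "set (served a r h S) = {u\<in>set (coverable a r). \<exists>f\<in>set S. near a r (centre a r h u) f}"
  unfolding served_def by auto

lemma length_served: "length (served a r h S) =
    card {u\<in>set (coverable a r). \<exists>f\<in>set S. near a r (centre a r h u) f}"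
  using distinct_card[OF distinct_served] set_served by metis

lemma centre_cust: "u \<in> set (coverable a r) \<Longrightarrow> centre a r h u \<in> custs I"
  using centre_centres centres_coverable set_coverable by blast

text \<open>The route leads from \<open>u\<close> over a facility \<open>g\<close> that witnesses
  its link, to the centre, and on to \<open>f\<close>: three legs of length at most
  \<open>r\<close>.\<close>

lemma served_within:
  assumes "u \<in> set (served a r h S)" "set S \<subseteq> facs I"
  shows "\<exists>f\<in>set S. metr I u f \<le> 3 * r"
proof -
  let ?w = "centre a r h u"
  obtain f where f: "f \<in> set S" "near a r ?w f" and u: "u \<in> set (coverable a r)"
    using assms(1) unfolding set_served by blast
  obtain g where g: "g \<in> facs I" "near a r u g" "near a r ?w g"
    using linked_centre[OF u, of h] unfolding linked_def facs by blast
  have pts: "u \<in> custs I" "?w \<in> custs I" "f \<in> facs I"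
    using u centre_cust[OF u] f assms(2) set_coverable by auto
  have "metr I u f \<le> metr I u ?w + metr I ?w f"
    using pts by (intro triangle) auto
  moreover have "metr I u ?w \<le> metr I u g + metr I g ?w"
    using pts g by (intro triangle) auto
  moreover have "metr I u g \<le> r" "metr I ?w g \<le> r" "metr I ?w f \<le> r"
    using f g pts near_iff by auto
  ultimately show ?thesis using f(1) commute[of g ?w] by force
qed

section \<open>The F-PCM instance of a round\<close>

definition pcm_of :: "real \<Rightarrow> nat list \<Rightarrow> pcm" where
  "pcm_of r h = \<lparr>pcm_facs = facs I, pcm_fam = fam I,
     pcm_parts = (\<lambda>w. {f\<in>facs I. near a r w f}) ` set (centres a r h),
     pcm_val = (\<lambda>f. length (served a r h [f]))\<rparr>"

lemma pcm_of_instance: "pcm_of r h \<in> pcm_instances_of I"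
proof -
  have parts: "pcm_parts (pcm_of r h) = (\<lambda>w. {f\<in>facs I. near a r w f}) ` set (centres a r h)"
    unfolding pcm_of_def by simp
  have "disjoint (pcm_parts (pcm_of r h))"
  proof (rule disjointI)
    fix A B assume "A \<in> pcm_parts (pcm_of r h)" "B \<in> pcm_parts (pcm_of r h)" and AB: "A \<noteq> B"
    then obtain w w' where w: "w \<in> set (centres a r h)" "w' \<in> set (centres a r h)"
      "A = {f\<in>facs I. near a r w f}" "B = {f\<in>facs I. near a r w' f}"
      unfolding parts by (elim imageE)
    then have "w \<noteq> w'" using AB by metis
    then show "A \<inter> B = {}" using centres_unique[OF w(1,2)] unfolding w(3,4) by fast
  qed
  moreover have "pcm_val (pcm_of r h) f = pcm_val (pcm_of r h) g"
    if A: "A \<in> pcm_parts (pcm_of r h)" "f \<in> A" "g \<in> A" for A f g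
  proof -
    obtain w where w: "w \<in> set (centres a r h)" "A = {f\<in>facs I. near a r w f}"
      using A(1) unfolding parts by (elim imageE)
    have f: "f \<in> facs I" "near a r w f" and g: "g \<in> facs I" "near a r w g"
      using A(2,3) unfolding w(2) by auto
    \<comment> \<open>Both facilities serve exactly the customers with centre \<open>w\<close>, so
      the value is constant on the part.\<close>
    have "served a r h [f] = served a r h [g]"
      unfolding served_def
      by (intro filter_cong refl) (simp add: centre_eq[OF _ w(1) f] centre_eq[OF _ w(1) g])
    then show ?thesis unfolding pcm_of_def by simp
  qed
  moreover have "length (served a r h [f]) \<le> card (custs I)" for f
    unfolding length_served by (rule card_mono[OF finite_custs]) (auto simp: set_coverable)
  moreover have "pcm_facs (pcm_of r h) = facs I" "pcm_fam (pcm_of r h) = fam I"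
    "pcm_val (pcm_of r h) = (\<lambda>f. length (served a r h [f]))"
    unfolding pcm_of_def by simp_all
  moreover have "pcm_parts (pcm_of r h) \<subseteq> Pow (facs I)"
    unfolding parts by auto
  ultimately show ?thesis
    using inst unfolding pcm_instances_of_def pcm_instance_def supplier_instance_def mem_Collect_eq
    by metis
qed

text \<open>Double counting of the pairs of a facility in \<open>S\<close> and a customer whose
  centre is near it. Feasibility allows one facility per centre, so no customer is counted
  twice.\<close>

lemma pcm_value_served:
  assumes "set S \<in> pcm_feasible (pcm_of r h)"
  shows "pcm_value (pcm_of r h) (set S) = length (served a r h S)"
proof -
  let ?V = "set (coverable a r)" and ?n = "\<lambda>u f. near a r (centre a r h u) f"
  have S: "set S \<subseteq> facs I"
    using assms fam_facs unfolding pcm_feasible_def pcm_of_def by auto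
  have one: "card {f\<in>set S. ?n u f} = (if \<exists>f\<in>set S. ?n u f then 1 else 0)" if "u \<in> ?V" for u
  proof (cases "\<exists>f\<in>set S. ?n u f")
    case True
    have "{f\<in>set S. ?n u f} = set S \<inter> {f\<in>facs I. ?n u f}" using S by auto
    then have "card {f\<in>set S. ?n u f} \<le> 1"
      using assms centre_centres[OF that, of h] unfolding pcm_feasible_def pcm_of_def by auto
    moreover have "card {f\<in>set S. ?n u f} \<noteq> 0" using True by auto
    ultimately have "card {f\<in>set S. ?n u f} = 1" by linarith
    then show ?thesis using True by simp
  qed (auto simp: card_eq_0_iff)
  have "pcm_value (pcm_of r h) (set S) = (\<Sum>f\<in>set S. \<Sum>u\<in>{u\<in>?V. ?n u f}. 1)"
    unfolding pcm_value_def by (simp add: pcm_of_def length_served)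
  also have "\<dots> = (\<Sum>u\<in>?V. \<Sum>f\<in>{f\<in>set S. ?n u f}. 1)"
    by (rule sum.swap_restrict) auto
  also have "\<dots> = (\<Sum>u\<in>?V. if \<exists>f\<in>set S. ?n u f then 1 else 0)"
    by (rule sum.cong) (simp_all add: one)
  also have "\<dots> = length (served a r h S)"
    unfolding length_served by (simp add: sum.If_cases Int_def)
  finally show ?thesis .
qed

lemma pcm_optimal_ge:
  assumes "pcm_optimal (pcm_of r h) S" "S' \<in> pcm_feasible (pcm_of r h)"
  shows "pcm_value (pcm_of r h) S' \<le> pcm_value (pcm_of r h) S"
proof -
  have "pcm_feasible (pcm_of r h) \<subseteq> Pow (facs I)"
    unfolding pcm_feasible_def pcm_of_def using fam_facs by auto
  then have "finite (pcm_feasible (pcm_of r h))"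
    using finite_facs by (meson finite_Pow_iff finite_subset)
  then show ?thesis using assms unfolding pcm_optimal_def pcm_opt_def by simp
qed

definition covered :: "real \<Rightarrow> nat set \<Rightarrow> nat set" where
  "covered r S = {u\<in>set (coverable a r). \<exists>f\<in>S. near a r u f}"

text \<open>\<open>S'\<close> may be infeasible, with several facilities in one part. Keeping a
  single near facility for each centre that has one in \<open>S'\<close> leaves a subset of
  \<open>S'\<close>, which is in the family by down-closedness and meets each part at most once. It
  still serves every customer whose centre is covered by \<open>S'\<close>.\<close>

lemma covered_centres_le:
  assumes opt: "pcm_optimal (pcm_of r h) (set S)" and S': "S' \<in> fam I"
  shows "card {u\<in>set (coverable a r). centre a r h u \<in> covered r S'} \<le> length (served a r h S)"
proof -
  define W where "W = {w\<in>set (centres a r h). \<exists>f\<in>S'. near a r w f}"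
  define pick where "pick w = (SOME f. f \<in> S' \<and> near a r w f)" for w
  have pick: "pick w \<in> S' \<and> near a r w (pick w)" if "w \<in> W" for w
    unfolding pick_def by (rule someI_ex) (use that in \<open>auto simp: W_def\<close>)
  have S'_facs: "S' \<subseteq> facs I" using S' by (rule fam_facs)
  obtain Q where Q: "set Q = pick ` W"
    using finite_list[of "pick ` W"] unfolding W_def by auto
  have Q_fam: "set Q \<in> fam I"
    using Q pick S' fam_down by (metis image_subsetI)
  have "card (set Q \<inter> {f\<in>facs I. near a r w f}) \<le> 1" if w: "w \<in> set (centres a r h)" for w
  proof -
    have "set Q \<inter> {f\<in>facs I. near a r w f} \<subseteq> {pick w}"
      using centres_unique[OF _ w] pick unfolding Q by (auto simp: W_def)
    then show ?thesis by (metis card.empty card.insert card_mono empty_iff finite.intros One_nat_def)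
  qed
  then have feas: "set Q \<in> pcm_feasible (pcm_of r h)"
    using Q_fam unfolding pcm_feasible_def pcm_of_def by auto
  have "card {u\<in>set (coverable a r). centre a r h u \<in> covered r S'} \<le> length (served a r h Q)"
    unfolding length_served
  proof (intro card_mono subsetI)
    fix u assume u: "u \<in> {u\<in>set (coverable a r). centre a r h u \<in> covered r S'}"
    then have "centre a r h u \<in> W"
      using centre_centres unfolding W_def covered_def by blast
    then show "u \<in> {u\<in>set (coverable a r). \<exists>f\<in>set Q. near a r (centre a r h u) f}"
      using u pick unfolding Q by auto
  qed simp
  also have "\<dots> = pcm_value (pcm_of r h) (set Q)"
    using pcm_value_served[OF feas] by simp
  also have "\<dots> \<le> pcm_value (pcm_of r h) (set S)"
    by (rule pcm_optimal_ge[OF opt feas])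
  also have "\<dots> = length (served a r h S)"
    by (rule pcm_value_served) (use opt in \<open>simp add: pcm_optimal_def\<close>)
  finally show ?thesis .
qed

text \<open>Empty if \<open>r\<close> is too small; \<open>potential\<close> then puts no limit on
  the number of failed rounds.\<close>

definition covers :: "real \<Rightarrow> nat set set" where
  "covers r = {covered r S |S. S \<in> fam I \<and> demand I \<le> card (covered r S)}"

text \<open>After a failed round, the number of customers sent into a cover is at most the value
  found, so below the demand and below the size of the cover.\<close>

lemma potential_round:
  assumes "potential (set (coverable a r)) (covers r) t h"
    and "pcm_optimal (pcm_of r h) (set S)" "length (served a r h S) < demand I"
  shows "potential (set (coverable a r)) (covers r) (Suc t) (map (centre a r h) (coverable a r) @ h)"
proof (rule potential_Suc[OF assms(1) distinct_coverable refl])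
  show "centre a r h ` set (coverable a r) \<subseteq> set (coverable a r)"
    using centre_centres centres_coverable by blast
  show "occurrences h (centre a r h u) \<le> occurrences h u" if "u \<in> set (coverable a r)" for u
    using that by (rule occurrences_centre)
  show "X \<subseteq> set (coverable a r) \<and> card {u\<in>set (coverable a r). centre a r h u \<in> X} < card X"
    if X: "X \<in> covers r" for X
  proof -
    obtain S' where "X = covered r S'" "S' \<in> fam I" "demand I \<le> card X"
      using X unfolding covers_def by auto
    then show ?thesis
      using covered_centres_le[OF assms(2), of S'] assms(3) unfolding covered_def by auto
  qed
qed


section \<open>The invariant of the main loop\<close>

definition sound :: "real \<times> nat list \<times> nat list \<Rightarrow> bool" where
  "sound = (\<lambda>(r, S, U). distinct S \<and> set S \<in> fam I \<and> distinct U \<and> set U \<subseteq> custs I \<and>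
     demand I \<le> length U \<and> (\<forall>u\<in>set U. \<exists>f\<in>set S. metr I u f \<le> 3 * r))"

text \<open>Bounds the new cells of one round, with n = \<open>sz a\<close>: at most n history
  entries of n + 3 cells, and one solution with lists of size at most n each plus 4 cells of
  structure.\<close>

definition growth :: nat where
  "growth = sz a * (sz a + 3) + 2 * sz a + 4"

text \<open>For each \<open>r\<close>, either a guess of at most \<open>r\<close> has succeeded, or
  the potential holds after the \<open>t\<close> rounds spent on \<open>r\<close>, with
  \<open>t\<close> read off from the entries already removed. The last clause reserves
  \<open>growth\<close> for every round to come.\<close>

definition invariant :: "state \<Rightarrow> bool" where
  "invariant = (\<lambda>(rs, a', H, best). a' = a \<and>
     (\<forall>b\<in>set best. sound b) \<and> sorted_wrt (\<lambda>b b'. fst b \<le> fst b') best \<and>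
     (\<forall>r. (\<exists>b\<in>set best. fst b \<le> r) \<or>
        (\<exists>t. t + count_list rs r = count_list (fst (init_state a)) r \<and>
           potential (set (coverable a r)) (covers r) t (visits H r))) \<and>
     sz (rs, a', H, best) + length rs * growth
       \<le> sz (init_state a) + length (fst (init_state a)) * growth)"

lemma invariant_init: "invariant (init_state a)"
  unfolding invariant_def by (auto simp: init_state_def visits_def intro: potential_zero)

lemma visits_append: "visits (H @ H') r = visits H r @ visits H' r"
  unfolding visits_def by simp

lemma visits_map: "visits (map (\<lambda>u. (r', c u)) us) r = (if r' = r then map c us else [])"
  unfolding visits_def by (simp add: filter_map comp_def)

lemma invariant_step:
  assumes inv: "invariant (r # rs, a', H, best)"
    and S: "distinct S" "pcm_optimal (pcm_of r (visits H r)) (set S)"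
  shows "invariant (step (r # rs, a', H, best) S)"
proof -
  define h where "h = visits H r"
  define U where "U = served a r h S"
  define H' where "H' = map (\<lambda>u. (r, centre a r h u)) (coverable a r) @ H"
  define best' where "best' = (if demand I \<le> length U \<and> (\<forall>b\<in>set best. r \<le> fst b)
      then (r, S, U) # best else best)"
  have a': "a' = a" using inv unfolding invariant_def by simp
  have step: "step (r # rs, a', H, best) S = (rs, a, H', best')"
    unfolding step_def Let_def a' H'_def best'_def U_def h_def by (simp add: demand)
  have S_fam: "set S \<in> fam I"
    using S(2) unfolding pcm_optimal_def pcm_feasible_def pcm_of_def by simp
  have S_facs: "set S \<subseteq> facs I" using S_fam by (rule fam_facs)
  have "sound (r, S, U)" if "demand I \<le> length U"
  proof -
    have "\<exists>f\<in>set S. metr I u f \<le> 3 * r" if "u \<in> set U" for u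
      using served_within[OF _ S_facs] that unfolding U_def by blast
    moreover have "set U \<subseteq> custs I" "distinct U"
      unfolding U_def by (auto simp: distinct_served set_served set_coverable)
    ultimately show ?thesis using that S(1) S_fam unfolding sound_def by auto
  qed
  then have sound: "\<forall>b\<in>set best'. sound b"
    using inv unfolding invariant_def best'_def by auto
  have sorted: "sorted_wrt (\<lambda>b b'. fst b \<le> fst b') best'"
    using inv unfolding invariant_def best'_def by auto
  have visits': "visits H' q = (if q = r then map (centre a r h) (coverable a r) else []) @ visits H q"
    for q
    unfolding H'_def by (simp add: visits_append visits_map)
  have pot: "(\<exists>b\<in>set best'. fst b \<le> q) \<or>
      (\<exists>t. t + count_list rs q = count_list (fst (init_state a)) q \<and>
           potential (set (coverable a q)) (covers q) t (visits H' q))" for q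
  proof (cases "\<exists>b\<in>set best. fst b \<le> q")
    case True
    then show ?thesis unfolding best'_def by auto
  next
    case False
    then obtain t where t: "t + count_list (r # rs) q = count_list (fst (init_state a)) q"
      "potential (set (coverable a q)) (covers q) t (visits H q)"
      using inv unfolding invariant_def by blast
    show ?thesis
    proof (cases "q = r")
      case True
      show ?thesis
      proof (cases "demand I \<le> length U")
        case demand: True
        \<comment> \<open>No recorded guess is at most \<open>r\<close> so far, hence the new
          solution is recorded.\<close>
        then show ?thesis using True unfolding best'_def by (auto simp: not_le intro: less_imp_le)
      next
        case demand: False
        then have "potential (set (coverable a r)) (covers r) (Suc t) (visits H' r)"
          using potential_round[of r t h S] t(2) S(2) True
          unfolding visits' U_def h_def by simp
        then show ?thesis using t(1) True by (intro disjI2 exI[of _ "Suc t"]) simp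
      qed
    next
      case neq: False
      then show ?thesis using t by (auto simp: visits')
    qed
  qed
  have "sz (rs, a, H', best') + length rs * growth \<le> sz (r # rs, a, H, best) + length (r # rs) * growth"
  proof -
    define n where "n = sz a"
    have n: "sz (in_facs a) \<le> n" "sz (in_custs a) \<le> n"
      unfolding n_def by (cases a; simp)+
    have "sz (centre a r h u) \<le> n" if "u \<in> set (coverable a r)" for u
      using centre_cust[OF that] sz_elem[of "centre a r h u" "in_custs a"] n custs by simp
    then have "sz (map (\<lambda>u. (r, centre a r h u)) (coverable a r))
        \<le> 1 + length (coverable a r) * ((n + 2) + 1)"
      by (intro sz_map_le) auto
    also have "\<dots> \<le> 1 + n * (n + 3)"
    proof -
      have "length (coverable a r) \<le> n"
        unfolding coverable_def
        using length_filter_le[of _ "in_custs a"] length_le_sz[of "in_custs a"] n by (meson le_trans)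
      then show ?thesis by (intro add_left_mono mult_le_mono) auto
    qed
    finally have H': "sz H' \<le> sz H + n * (n + 3)"
      unfolding H'_def
      using sz_append[of "map (\<lambda>u. (r, centre a r h u)) (coverable a r)" H] by simp
    \<comment> \<open>The solver's answer is bounded through its content, a set of
      facilities.\<close>
    have "sz S \<le> n"
      using sz_distinct[OF S(1), of "in_facs a"] S_facs facs n by simp
    moreover have "sz U \<le> n"
    proof -
      have "set U \<subseteq> set (in_custs a)" "distinct U"
        unfolding U_def custs by (auto simp: distinct_served set_served set_coverable)
      then show ?thesis using sz_distinct[of U "in_custs a"] n by simp
    qed
    ultimately have "sz S + sz U \<le> 2 * n" by linarith
    then have "sz best' \<le> sz best + (2 * n + 4)"
      unfolding best'_def by simp
    moreover have "sz (rs, a, H', best') = sz rs + sz a + sz H' + sz best' + 3"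
      "sz (r # rs, a, H, best) = sz (r # rs) + sz a + sz H + sz best + 3"
      by simp_all
    moreover have "length (r # rs) * growth = length rs * growth + growth" "sz (r # rs) = sz rs + 2"
      by simp_all
    ultimately show ?thesis using H' growth_def[folded n_def] by linarith
  qed
  moreover have "sz (r # rs, a, H, best) + length (r # rs) * growth
      \<le> sz (init_state a) + length (fst (init_state a)) * growth"
    using inv unfolding invariant_def a' case_prod_conv by blast
  ultimately show ?thesis
    using sound sorted pot unfolding step invariant_def case_prod_conv by (blast intro: le_trans)
qed

text \<open>The customers serve as loop counters; the extra 0 lifts n to n + 1, so the count
  strictly exceeds the perceptron bound. Other table entries with the same distance can only add to
  it.\<close>

lemma count_init:
  assumes "e \<in> set (in_dist a)"
  shows "(length (in_custs a) + 1) ^ 3 \<le> count_list (fst (init_state a)) (snd e)"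
proof -
  define ks where "ks = 0 # in_custs a"
  define block where "block e = concat (map (\<lambda>i. concat (map (\<lambda>j. map (\<lambda>k. snd e) ks) ks)) ks)"
    for e :: "(nat \<times> nat) \<times> real"
  have const: "count_list (concat (map (\<lambda>i. L) ks)) r = length ks * count_list L r"
    for L :: "real list" and ks :: "nat list" and r
    by (induction ks) auto
  have single: "count_list (map (\<lambda>k. r) ks) r = length ks" for ks :: "nat list" and r :: real
    by (induction ks) auto
  have "count_list (block e) (snd e) = length ks ^ 3"
    unfolding block_def const single by (simp add: power3_eq_cube)
  moreover obtain xs ys where "in_dist a = xs @ e # ys"
    using split_list[OF assms] by blast
  then have "fst (init_state a) = concat (map block xs) @ block e @ concat (map block ys)"
    unfolding init_state_def block_def ks_def by simp
  ultimately show ?thesis unfolding ks_def by simp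
qed

text \<open>Once the list is exhausted, a correct guess without a recorded solution would have gone
  through at least \<open>(n + 1)^3\<close> rounds, against the bound \<open>n^3\<close>.\<close>

lemma invariant_final:
  assumes "invariant ([], a', H, best)" "e \<in> set (in_dist a)" "S \<in> fam I"
    and "demand I \<le> card (covered (snd e) S)"
  shows "\<exists>b\<in>set best. fst b \<le> snd e"
proof (rule ccontr)
  assume "\<not> ?thesis"
  then obtain t where t: "t = count_list (fst (init_state a)) (snd e)"
    "potential (set (coverable a (snd e))) (covers (snd e)) t (visits H (snd e))"
    using assms(1) unfolding invariant_def by auto
  have "t \<le> card (set (coverable a (snd e))) ^ 3"
    by (rule potential_bound[OF _ _ _ t(2), of "covered (snd e) S"])
      (use assms(3,4) in \<open>auto simp: covers_def covered_def\<close>)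
  also have "\<dots> \<le> length (in_custs a) ^ 3"
    using distinct_card[OF distinct_coverable] unfolding coverable_def
    by (intro power_mono) auto
  also have "\<dots> < (length (in_custs a) + 1) ^ 3"
    by (intro power_strict_mono) auto
  finally show False using count_init[OF assms(2)] t(1) by simp
qed

end

section \<open>The approximation guarantee\<close>

lemma supplier_cost_le:
  "supplier_cost I (S, U) \<le> c \<longleftrightarrow> (\<forall>u\<in>U. set_dist I u S \<le> c)"
  unfolding supplier_cost_def by (simp add: SUP_le_iff)

lemma set_dist_attained:
  assumes "finite S" "S \<noteq> {}"
  obtains f where "f \<in> S" "set_dist I u S = ennreal (metr I u f)"
proof -
  have "set_dist I u S \<in> (\<lambda>f. ennreal (metr I u f)) ` S"
    unfolding set_dist_def using assms Min_in[of "(\<lambda>f. ennreal (metr I u f)) ` S"]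
    by (simp add: cInf_eq_Min)
  then show ?thesis using that by blast
qed

context encoded_instance
begin

lemma opt_attained:
  assumes "{} \<in> fam I"
  obtains S U where "(S, U) \<in> supplier_feasible I" "supplier_opt I = supplier_cost I (S, U)"
proof -
  have sub: "supplier_feasible I \<subseteq> Pow (facs I) \<times> Pow (custs I)"
    unfolding supplier_feasible_def using fam_facs by auto
  have fin: "finite (supplier_feasible I)"
    by (rule finite_subset[OF sub]) (simp add: finite_facs finite_custs)
  have ne: "({}, custs I) \<in> supplier_feasible I"
    unfolding supplier_feasible_def using assms demand_le by simp
  have "supplier_opt I \<in> supplier_cost I ` supplier_feasible I"
    unfolding supplier_opt_def
    using fin ne by (subst cInf_eq_Min) (auto intro!: Min_in simp del: Min_in)
  then show ?thesis using that by (metis imageE surj_pair)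
qed

text \<open>Minimum and maximum over finite sets are attained, so a finite cost is an entry of the
  table; this is why trying the table entries as guesses suffices.\<close>

lemma finite_cost_radius:
  assumes X: "(S, U) \<in> supplier_feasible I" and fin: "supplier_cost I (S, U) < top"
    and ne: "custs I \<noteq> {}"
  obtains e where "e \<in> set (in_dist a)" "0 \<le> snd e" "supplier_cost I (S, U) = ennreal (snd e)"
    "demand I \<le> card (covered (snd e) S)"
proof -
  have S: "S \<subseteq> facs I" "finite S" and U: "U \<subseteq> custs I" "finite U" "demand I \<le> card U"
    using X fam_facs finite_facs finite_custs unfolding supplier_feasible_def
    by (auto intro: finite_subset)
  have le: "set_dist I u S \<le> supplier_cost I (S, U)" if "u \<in> U" for u
    using that supplier_cost_le[of I S U] by auto
  have S_ne: "S \<noteq> {}" if "U \<noteq> {}"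
  proof
    assume "S = {}"
    then have "supplier_cost I (S, U) = top"
      using that unfolding supplier_cost_def set_dist_def by simp
    then show False using fin by simp
  qed
  obtain e where e: "e \<in> set (in_dist a)" "0 \<le> snd e" "supplier_cost I (S, U) = ennreal (snd e)"
  proof (cases "U = {}")
    case True
    \<comment> \<open>If \<open>U\<close> is empty the cost is 0, which is found on the diagonal of
      the table.\<close>
    obtain x where x: "x \<in> custs I" using ne by auto
    then have "((x, x), metr I x x) \<in> set (in_dist a)" unfolding dist by force
    moreover have "supplier_cost I (S, U) = ennreal (metr I x x)"
      using True x unfolding supplier_cost_def by (simp add: bot_ennreal)
    ultimately show ?thesis using that[of "((x, x), metr I x x)"] by simp
  next
    case False
    have "supplier_cost I (S, U) \<in> (\<lambda>u. set_dist I u S) ` U"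
      unfolding supplier_cost_def using U False Max_in[of "(\<lambda>u. set_dist I u S) ` U"]
      by (simp add: cSup_eq_Max)
    then obtain u where u: "u \<in> U" "supplier_cost I (S, U) = set_dist I u S" by blast
    obtain f where f: "f \<in> S" "set_dist I u S = ennreal (metr I u f)"
      using set_dist_attained[OF S(2) S_ne[OF False]] by blast
    have "((u, f), metr I u f) \<in> set (in_dist a)"
      using u f S U unfolding dist by force
    then show ?thesis using that[of "((u, f), metr I u f)"] u f by simp
  qed
  have "U \<subseteq> covered (snd e) S"
  proof
    fix u assume u: "u \<in> U"
    obtain f where f: "f \<in> S" "set_dist I u S = ennreal (metr I u f)"
      using set_dist_attained[OF S(2) S_ne] u by blast
    have "metr I u f \<le> snd e"
      using le[OF u] f(2) e(2,3) by simp
    then have "near a (snd e) u f" using u f(1) S U near_iff[of u f] by auto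
    then show "u \<in> covered (snd e) S"
      using u f(1) S U unfolding covered_def set_coverable by blast
  qed
  then have "demand I \<le> card (covered (snd e) S)"
    using U(3) card_mono[of "covered (snd e) S" U] unfolding covered_def by simp
  then show ?thesis using that e by blast
qed

text \<open>The head of \<open>best\<close> has the least recorded guess, so its guess is at most
  the optimum when that is finite, and soundness gives the factor 3. With an infinite optimum or no
  customers only feasibility is at stake.\<close>

lemma result_approx:
  assumes inv: "invariant ([], a', H, best)" and fam: "{} \<in> fam I"
    and SU: "result ([], a', H, best) = (S, U)"
  shows "distinct S \<and> distinct U \<and> approx_solution 3 I (set S, set U)"
proof -
  have feas: "distinct S \<and> distinct U \<and> (set S, set U) \<in> supplier_feasible I"
  proof (cases best)
    case Nil
    then have "S = []" "U = in_custs a" using SU inv unfolding result_def invariant_def by auto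
    then show ?thesis
      using fam custs demand_le unfolding supplier_feasible_def by auto
  next
    case (Cons b bs)
    then have "sound b" "snd b = (S, U)" using inv SU unfolding invariant_def result_def by auto
    then show ?thesis
      unfolding sound_def supplier_feasible_def by (cases b) (auto simp: distinct_card)
  qed
  have "supplier_cost I (set S, set U) \<le> 3 * supplier_opt I"
  proof (cases "custs I = {}")
    case True
    then have "set U = {}" using feas unfolding supplier_feasible_def by auto
    then show ?thesis unfolding supplier_cost_le by simp
  next
    case False
    obtain S' U' where opt: "(S', U') \<in> supplier_feasible I" "supplier_opt I = supplier_cost I (S', U')"
      using opt_attained[OF fam] .
    show ?thesis
    proof (cases "supplier_opt I = top")
      case True
      then show ?thesis by (simp add: ennreal_mult_top)
    next
      case fin: False
      then have "supplier_cost I (S', U') < top" using opt(2) by (simp add: less_top)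
      then obtain e where e: "e \<in> set (in_dist a)" "0 \<le> snd e" "supplier_opt I = ennreal (snd e)"
        "demand I \<le> card (covered (snd e) S')"
        using finite_cost_radius[OF opt(1) _ False] opt(2) by metis
      have "S' \<in> fam I" using opt(1) unfolding supplier_feasible_def by simp
      from invariant_final[OF inv e(1) this e(4)]
      obtain b' where b': "b' \<in> set best" "fst b' \<le> snd e" by blast
      then obtain b bs where best: "best = b # bs" by (cases best) auto
      obtain r S1 U1 where b: "b = (r, S1, U1)" by (cases b) auto
      have eq: "S1 = S" "U1 = U" using SU unfolding result_def best b by simp_all
      have "r \<le> fst b'" using inv b'(1) unfolding invariant_def best b by auto
      then have r: "r \<le> snd e" using b'(2) by linarith
      have "sound (r, S, U)" using inv unfolding invariant_def best b eq by simp
      then have within: "\<forall>u\<in>set U. \<exists>f\<in>set S. metr I u f \<le> 3 * r"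
        unfolding sound_def by simp
      have "set_dist I u (set S) \<le> 3 * supplier_opt I" if u: "u \<in> set U" for u
      proof -
        obtain f where f: "f \<in> set S" "metr I u f \<le> 3 * snd e"
          using within u r by force
        have "set_dist I u (set S) \<le> ennreal (metr I u f)"
          unfolding set_dist_def using f(1) by (rule INF_lower)
        also have "\<dots> \<le> ennreal (3 * snd e)" using f(2) by (rule ennreal_leI)
        also have "\<dots> = 3 * supplier_opt I"
          using e(2) unfolding e(3) by (simp add: ennreal_mult)
        finally show ?thesis .
      qed
      then show ?thesis unfolding supplier_cost_le by blast
    qed
  qed
  then show ?thesis using feas unfolding approx_solution_def by simp
qed

end

section \<open>Encodings of the two problems\<close>

lemma list_all2_enc:
  assumes "\<And>x b. R x b \<longleftrightarrow> b = enc x"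
  shows "list_all2 R xs bs \<longleftrightarrow> bs = map enc xs"
proof
  show "bs = map enc xs" if "list_all2 R xs bs"
    using that by (induction rule: list_all2_induct) (auto simp: assms)
  show "list_all2 R xs bs" if "bs = map enc xs"
    unfolding that by (induction xs) (auto simp: assms)
qed

text \<open>If elements have a unique tree, the only freedom in representing a set is the order of
  the listing.\<close>

lemma repr_set_enc:
  assumes "\<And>x b. R x b \<longleftrightarrow> b = enc x"
  shows "repr_set R A b \<longleftrightarrow> (\<exists>xs. distinct xs \<and> set xs = A \<and> b = enc xs)"
  unfolding repr_set_def list_all2_enc[OF assms] enc_list_def by blast

lemma repr_nat_enc: "repr_nat n b \<longleftrightarrow> b = enc n"
  unfolding repr_nat_def by simp

lemma repr_pair_enc:
  assumes "\<And>x b. R x b \<longleftrightarrow> b = enc x" "\<And>x b. Q x b \<longleftrightarrow> b = enc x"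
  shows "repr_pair R Q p b \<longleftrightarrow> b = enc p"
  unfolding repr_pair_def by (simp add: assms)

lemmas repr_nat_set_enc = repr_set_enc[OF repr_nat_enc]

lemma supplier_input_decode:
  assumes "supplier_instance I" "supplier_input \<phi> I b"
  obtains a where "b = enc a" "in_desc a = \<phi>" "encoded_instance I a"
proof -
  have real: "repr_real r b \<longleftrightarrow> b = enc r" for r b
    unfolding repr_real_def by simp
  note table = repr_set_enc[OF repr_pair_enc[OF repr_pair_enc[OF repr_nat_enc repr_nat_enc] real]]
  from assms(2) obtain f c d m where b: "b = list_tree [f, c, d, m, \<phi>]"
    and r: "repr_set repr_nat (facs I) f" "repr_set repr_nat (custs I) c"
      "repr_fun (repr_pair repr_nat repr_nat) repr_real
          ((facs I \<union> custs I) \<times> (facs I \<union> custs I)) (\<lambda>(x, y). metr I x y) d"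
      "repr_nat (demand I) m"
    unfolding supplier_input_def by blast
  obtain fs where fs: "distinct fs" "set fs = facs I" "f = enc fs"
    using r(1) unfolding repr_nat_set_enc by blast
  obtain cs where cs: "distinct cs" "set cs = custs I" "c = enc cs"
    using r(2) unfolding repr_nat_set_enc by blast
  obtain D where D: "set D = (\<lambda>x. (x, case x of (x, y) \<Rightarrow> metr I x y)) `
      ((facs I \<union> custs I) \<times> (facs I \<union> custs I))" "d = enc D"
    using r(3) unfolding repr_fun_def table by blast
  let ?a = "(fs, cs, D, demand I, \<phi>, Tip) :: input"
  have "b = enc ?a" using b fs cs D r(4) by (simp add: repr_nat_def)
  moreover have "encoded_instance I ?a"
    by (rule encoded_instance.intro) (simp_all add: assms(1) fs cs D split_def)
  ultimately show ?thesis using that[of ?a] by simp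
qed

lemma (in encoded_instance) pcm_input_query:
  "pcm_input (in_desc a) (pcm_of r h) (enc (query a r h))"
proof -
  let ?part = "\<lambda>w. {f\<in>facs I. near a r w f}" and ?ws = "centres a r h"
  \<comment> \<open>The listing of the parts must not repeat one. Centres are coverable, so parts
    are nonempty, and disjointness makes them different.\<close>
  have "inj_on ?part (set ?ws)"
  proof (rule inj_onI)
    fix w w' assume w: "w \<in> set ?ws" "w' \<in> set ?ws" "?part w = ?part w'"
    have "w \<in> set (coverable a r)" using w(1) centres_coverable by (rule rev_subsetD)
    then obtain f where f: "f \<in> ?part w" unfolding set_coverable by auto
    then have "f \<in> ?part w'" unfolding w(3) .
    then show "w = w'" using f centres_unique[OF w(1,2), of f] by simp
  qed
  then have 1: "distinct (map ?part ?ws)"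
    by (simp add: distinct_map distinct_centres)
  have "repr_set repr_nat (?part w) (enc [f\<leftarrow>in_facs a. near a r w f])" for w
    unfolding repr_nat_set_enc
    by (intro exI[of _ "[f\<leftarrow>in_facs a. near a r w f]"]) (auto simp: facs)
  \<comment> \<open>A part has several representing trees, so \<open>repr_set_enc\<close> does not
    cover sets of parts and the lists are matched entry by entry.\<close>
  then have "list_all2 (repr_set repr_nat) (map ?part ?ws)
      (map enc (map (\<lambda>w. [f\<leftarrow>in_facs a. near a r w f]) ?ws))"
    by (simp add: list_all2_conv_all_nth)
  then have parts: "repr_set (repr_set repr_nat) (?part ` set ?ws)
      (enc (map (\<lambda>w. [f\<leftarrow>in_facs a. near a r w f]) ?ws))"
    unfolding repr_set_def[of "repr_set repr_nat"]
    by (intro exI conjI) (rule 1, rule set_map, assumption, rule enc_list_def)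
  have vals: "repr_fun repr_nat repr_nat (facs I) (\<lambda>f. length (served a r h [f]))
      (enc (map (\<lambda>f. (f, length (served a r h [f]))) (in_facs a)))"
    unfolding repr_fun_def repr_set_enc[OF repr_pair_enc[OF repr_nat_enc repr_nat_enc]]
    by (intro exI[of _ "map (\<lambda>f. (f, length (served a r h [f]))) (in_facs a)"])
      (auto simp: facs distinct_map inj_on_def)
  \<comment> \<open>The singleton list in \<open>query\<close> supplies the final \<open>Tip\<close>
    of this list.\<close>
  have "enc (query a r h) = list_tree [enc (in_facs a), in_desc a,
      enc (map (\<lambda>w. [f\<leftarrow>in_facs a. near a r w f]) ?ws),
      enc (map (\<lambda>f. (f, length (served a r h [f]))) (in_facs a))]"
    unfolding query_def by simp
  moreover have "repr_set repr_nat (facs I) (enc (in_facs a))"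
    unfolding repr_nat_set_enc using facs by blast
  moreover have "pcm_facs (pcm_of r h) = facs I" "pcm_parts (pcm_of r h) = ?part ` set ?ws"
    "pcm_val (pcm_of r h) = (\<lambda>f. length (served a r h [f]))"
    unfolding pcm_of_def by simp_all
  ultimately show ?thesis
    unfolding pcm_input_def using parts vals by auto
qed

section \<open>The program\<close>

text \<open>Yields \<open>1 \<le> T J\<close> for every solvable instance, which allows additive
  costs to be absorbed into a multiple of \<open>T J\<close>.\<close>

lemma exec_pos: "exec orc c s t s' \<Longrightarrow> 0 < t"
  by (induction rule: exec.induct) auto

lemma runs_pos: "runs orc c b b' t \<Longrightarrow> 0 < t"
  unfolding runs_def using exec_pos by blast

definition loop_body :: "com \<Rightarrow> com \<Rightarrow> com \<Rightarrow> com" where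
  "loop_body c A d = Seq (Call 1 c (Var 0)) (Seq (Call 1 A (Var 1)) (Call 0 d (Pair (Var 0) (Var 1))))"

text \<open>Rounds may be charged to different instances; the induction keeps one with the largest
  bound. A round costs \<open>2 * K + 11\<close> plus the solver's time, so at most
  \<open>2 * K + 12\<close> times that largest bound. The 3 pays for the final test.\<close>

lemma exec_within_loop:
  fixes st :: "'i::encodable list \<times> 's::encodable" and q :: "'i list \<times> 's \<Rightarrow> 'q::encodable"
    and next_st :: "'i list \<times> 's \<Rightarrow> 'r::encodable \<Rightarrow> 'i list \<times> 's"
  assumes J: "\<J> \<noteq> {}" "\<And>J. J \<in> \<J> \<Longrightarrow> 1 \<le> T J"
    and round: "\<And>st. P st \<Longrightarrow> fst st \<noteq> [] \<Longrightarrow> \<exists>S. \<exists>J\<in>\<J>.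
      runs_within orc c (enc st) (enc (q st)) K \<and>
      runs_within orc A (enc (q st)) (enc S) (T J) \<and>
      runs_within orc d (enc (st, S)) (enc (next_st st S)) K \<and>
      P (next_st st S) \<and> fst (next_st st S) = tl (fst st)"
    and "P st" "s 0 = enc st"
  shows "\<exists>st' s'. \<exists>J\<in>\<J>. P st' \<and> fst st' = [] \<and> s' 0 = enc st' \<and>
    exec_within orc (While (Fst (Var 0)) (loop_body c A d)) s
      ((length (fst st) * (2 * K + 12) + 3) * T J) s'"
  using assms(4,5)
proof (induction "fst st" arbitrary: st s)
  case Nil
  obtain J where J': "J \<in> \<J>" using J(1) by blast
  have "exec_within orc (While (Fst (Var 0)) (loop_body c A d)) s (1 + expr_cost (Fst (Var 0))) s"
    by (rule exec_within_While_Tip) (use Nil in \<open>simp flip: Nil(1)\<close>)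
  then have "exec_within orc (While (Fst (Var 0)) (loop_body c A d)) s
      ((length (fst st) * (2 * K + 12) + 3) * T J) s"
    by (rule exec_within_mono) (use J(2)[OF J'] Nil(1) in \<open>simp flip: Nil(1)\<close>)
  then show ?case using J' Nil by metis
next
  case (Cons i rs)
  have st: "fst st \<noteq> []" using Cons.hyps(2) by (metis list.distinct(1))
  obtain S J where J1: "J \<in> \<J>"
    and run: "runs_within orc c (enc st) (enc (q st)) K"
      "runs_within orc A (enc (q st)) (enc S) (T J)"
      "runs_within orc d (enc (st, S)) (enc (next_st st S)) K"
    and nxt: "P (next_st st S)" "fst (next_st st S) = tl (fst st)"
    using round[OF Cons.prems(1) st] by blast
  let ?s1 = "s(1 := enc (q st))" and ?s2 = "s(1 := enc S)"
  let ?s3 = "s(1 := enc S, 0 := enc (next_st st S))"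
  have "exec_within orc (loop_body c A d) s ((2 + K) + ((2 + T J) + (4 + K))) ?s3"
    unfolding loop_body_def
  proof (intro exec_within_Seq)
    show "exec_within orc (Call 1 c (Var 0)) s (2 + K) ?s1"
      by (rule exec_within_Call[OF _ run(1)]) (use Cons.prems in auto)
    show "exec_within orc (Call 1 A (Var 1)) ?s1 (2 + T J) ?s2"
      by (rule exec_within_Call[OF _ run(2)]) auto
    show "exec_within orc (Call 0 d (Pair (Var 0) (Var 1))) ?s2 (4 + K) ?s3"
      by (rule exec_within_Call[OF _ run(3)]) (use Cons.prems in auto)
  qed
  note body = this
  have len: "length (fst st) = Suc (length (fst (next_st st S)))"
    using nxt(2) st by (cases "fst st") auto
  have "rs = fst (next_st st S)" using nxt(2) Cons.hyps(2) by (metis list.sel(3))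
  from Cons.hyps(1)[OF this nxt(1), of ?s3]
  obtain st' s' J' where J2: "J' \<in> \<J>" and fin: "P st'" "fst st' = []" "s' 0 = enc st'"
    and ex: "exec_within orc (While (Fst (Var 0)) (loop_body c A d)) ?s3
      ((length (fst (next_st st S)) * (2 * K + 12) + 3) * T J') s'"
    by auto
  have "eval_expr orc (Fst (Var 0)) s \<noteq> Tip"
    using Cons.prems(2) st by (cases "fst st") auto
  from exec_within_While[OF this body ex]
  have whole: "exec_within orc (While (Fst (Var 0)) (loop_body c A d)) s
      (1 + expr_cost (Fst (Var 0)) + ((2 + K) + ((2 + T J) + (4 + K)))
        + (length (fst (next_st st S)) * (2 * K + 12) + 3) * T J') s'" .
  obtain M where M: "M \<in> \<J>" "T J \<le> T M" "T J' \<le> T M"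
    using J1 J2 by (metis nle_le)
  have "11 + 2 * K \<le> (2 * K + 11) * T M"
    using mult_le_mono2[OF J(2)[OF M(1)], of "2 * K + 11"]
    unfolding mult_1_right by linarith
  moreover have "(length (fst (next_st st S)) * (2 * K + 12) + 3) * T J'
      \<le> (length (fst (next_st st S)) * (2 * K + 12) + 3) * T M"
    using M(3) by (rule mult_le_mono2)
  moreover have "(length (fst st) * (2 * K + 12) + 3) * T M = (2 * K + 11) * T M + T M
      + (length (fst (next_st st S)) * (2 * K + 12) + 3) * T M"
    unfolding len by (simp add: algebra_simps)
  moreover have "1 + expr_cost (Fst (Var 0)) + ((2 + K) + ((2 + T J) + (4 + K))) = 11 + 2 * K + T J"
    by simp
  ultimately have "1 + expr_cost (Fst (Var 0)) + ((2 + K) + ((2 + T J) + (4 + K)))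
        + (length (fst (next_st st S)) * (2 * K + 12) + 3) * T J'
      \<le> (length (fst st) * (2 * K + 12) + 3) * T M"
    using M(2) by linarith
  from exec_within_mono[OF whole this] show ?case using M(1) fin by blast
qed

lemma state_query_Cons: "state_query (r # rs, a, H, best) = query a r (visits H r)"
  unfolding state_query_def by simp

lemma (in encoded_instance) solve_query:
  assumes "pcm_solves_within orc (in_desc a) A (pcm_of r h) n"
  obtains S where "runs_within orc A (enc (query a r h)) (enc S) n" "1 \<le> n" "distinct S"
    "pcm_optimal (pcm_of r h) (set S)"
proof -
  obtain b t S where "runs orc A (enc (query a r h)) b t" "t \<le> n" "repr_set repr_nat S b"
    "pcm_optimal (pcm_of r h) S"
    using assms pcm_input_query unfolding pcm_solves_within_def by blast
  then show ?thesis
    using that runs_pos unfolding repr_nat_set_enc runs_within_def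
    by (metis One_nat_def Suc_leI le_trans)
qed

definition program :: "com \<Rightarrow> com \<Rightarrow> com \<Rightarrow> com \<Rightarrow> com \<Rightarrow> com" where
  "program i c d f A = Seq (Call 0 i (Var 0))
     (Seq (While (Fst (Var 0)) (loop_body c A d)) (Call 0 f (Var 0)))"

text \<open>\<open>[:4, 5, 1:]\<close> is \<open>growth\<close> as a polynomial in
  \<open>sz a\<close>, and \<open>pI\<close> bounds both the initial state and the number of rounds;
  so \<open>pB\<close> bounds every state and \<open>2 * pK + [:12:]\<close> a round. The 7 is 2 + 3
  + 2 for the first call, the final test and the last call.\<close>

lemma (in encoded_instance) program_correct:
  assumes A: "\<And>J. J \<in> pcm_instances_of I \<Longrightarrow> pcm_solves_within orc (in_desc a) A J (T J)"
    and i: "computes i init_state pI" and c: "computes c state_query pQ"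
    and d: "computes d (\<lambda>z. step (fst z) (snd z)) pS" and f: "computes f result pR"
  defines "pB \<equiv> pI + pI * [:4, 5, 1:]"
  defines "pK \<equiv> pcompose pQ pB + pcompose pS ([:1, 1:] + pB)"
  shows "\<exists>S U. \<exists>J\<in>pcm_instances_of I. distinct S \<and> distinct U \<and> approx_solution 3 I (set S, set U) \<and>
    runs_within orc (program i c d f A) (enc a) (enc (S, U))
      (poly ([:7:] + pI + pI * (2 * pK + [:12:]) + pcompose pR pB) (sz a) * T J)"
proof -
  let ?JJ = "{J \<in> pcm_instances_of I. 1 \<le> T J}"
  let ?n = "sz a"
  define K where "K = poly pK ?n"
  have init: "sz (init_state a) \<le> poly pI ?n" "length (fst (init_state a)) \<le> poly pI ?n"
  proof -
    show 1: "sz (init_state a) \<le> poly pI ?n" by (rule computes_sz[OF i order_refl])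
    have "sz (fst (init_state a)) \<le> sz (init_state a)" by simp
    then show "length (fst (init_state a)) \<le> poly pI ?n"
      using 1 length_le_sz[of "fst (init_state a)"] by linarith
  qed
  \<comment> \<open>One solved instance, here for the guess 0, shows that the family is nonempty and
    so contains \<open>{}\<close>. It also provides an instance to charge if the list of guesses is
    empty.\<close>
  obtain S0 where S0: "1 \<le> T (pcm_of 0 [])" "pcm_optimal (pcm_of 0 []) (set S0)"
    using solve_query[OF A[OF pcm_of_instance]] by metis
  then have ne: "?JJ \<noteq> {}" using pcm_of_instance by blast
  have fam: "{} \<in> fam I"
    using S0(2) fam_down unfolding pcm_optimal_def pcm_feasible_def pcm_of_def by auto
  have sz_st: "sz st \<le> poly pB ?n" if "invariant st" for st
  proof -
    obtain rs a' H best where st: "st = (rs, a', H, best)" by (metis surj_pair)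
    have "sz st \<le> sz (init_state a) + length (fst (init_state a)) * growth"
      using that unfolding invariant_def st by auto
    also have "\<dots> \<le> poly pI ?n + poly pI ?n * growth"
      using init by (intro add_mono mult_le_mono1)
    also have "\<dots> = poly pB ?n"
      unfolding growth_def pB_def by (simp add: algebra_simps)
    finally show ?thesis .
  qed
  have round: "\<exists>S. \<exists>J\<in>?JJ.
      runs_within orc c (enc st) (enc (state_query st)) K \<and>
      runs_within orc A (enc (state_query st)) (enc S) (T J) \<and>
      runs_within orc d (enc (st, S)) (enc (step st S)) K \<and>
      invariant (step st S) \<and> fst (step st S) = tl (fst st)"
    if st: "invariant st" "fst st \<noteq> []" for st
  proof -
    obtain r rs a' H best where st': "st = (r # rs, a', H, best)"
      using st(2) by (cases st; cases "fst st") auto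
    have a': "a' = a" using st(1) unfolding st' invariant_def by simp
    obtain S where S: "runs_within orc A (enc (state_query st)) (enc S) (T (pcm_of r (visits H r)))"
      "1 \<le> T (pcm_of r (visits H r))" "distinct S" "pcm_optimal (pcm_of r (visits H r)) (set S)"
      using solve_query[OF A[OF pcm_of_instance]] unfolding st' a' state_query_Cons by metis
    have "set S \<subseteq> set (in_facs a)"
      using S(4) fam_facs facs unfolding pcm_optimal_def pcm_feasible_def pcm_of_def by auto
    then have "sz S \<le> sz (in_facs a)" using S(3) by (intro sz_distinct)
    also have "\<dots> \<le> ?n" by (cases a) simp
    finally have "sz (st, S) \<le> poly ([:1, 1:] + pB) ?n"
      using sz_st[OF st(1)] by simp
    from computes_run[OF d this]
    have 1: "runs_within orc d (enc (st, S)) (enc (step st S)) (poly pS (poly ([:1, 1:] + pB) ?n))"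
      by simp
    have 2: "runs_within orc c (enc st) (enc (state_query st)) (poly pQ (poly pB ?n))"
      by (rule computes_run[OF c sz_st[OF st(1)]])
    have "runs_within orc c (enc st) (enc (state_query st)) K"
      "runs_within orc d (enc (st, S)) (enc (step st S)) K"
      by (rule runs_within_mono[OF 1] runs_within_mono[OF 2], simp add: K_def pK_def poly_pcompose)+
    moreover have "invariant (step st S)"
      using invariant_step st(1) S(3,4) unfolding st' by blast
    moreover have "fst (step st S) = tl (fst st)"
      unfolding st' step_def Let_def by simp
    ultimately show ?thesis using S(1,2) pcm_of_instance by blast
  qed
  let ?s = "start_store (enc a)"
  let ?s1 = "?s(0 := enc (init_state a))"
  have 1: "exec_within orc (Call 0 i (Var 0)) ?s (2 + poly pI ?n) ?s1"
    by (rule exec_within_Call[OF _ computes_run[OF i order_refl]]) (auto simp: start_store_def)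
  obtain st s2 J where J: "J \<in> ?JJ" and st: "invariant st" "fst st = []" "s2 0 = enc st"
    and 2: "exec_within orc (While (Fst (Var 0)) (loop_body c A d)) ?s1
      ((length (fst (init_state a)) * (2 * K + 12) + 3) * T J) s2"
    using exec_within_loop[of ?JJ T invariant orc c state_query K A d step "init_state a" ?s1,
        OF ne _ round invariant_init] by auto
  have 3: "exec_within orc (Call 0 f (Var 0)) s2 (2 + poly pR (poly pB ?n)) (s2(0 := enc (result st)))"
    by (rule exec_within_Call[OF _ computes_run[OF f sz_st[OF st(1)]]]) (use st in auto)
  have T: "1 \<le> T J" using J by simp
  have "(2 + poly pI ?n) + ((length (fst (init_state a)) * (2 * K + 12) + 3) * T J
        + (2 + poly pR (poly pB ?n)))
      \<le> (2 + poly pI ?n) * T J + ((poly pI ?n * (2 * K + 12) + 3) * T J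
        + (2 + poly pR (poly pB ?n)) * T J)"
    using T init(2) mult_le_mono2[OF T, of "2 + poly pI ?n"]
      mult_le_mono2[OF T, of "2 + poly pR (poly pB ?n)"]
    by (intro add_mono mult_le_mono) auto
  also have "\<dots> = poly ([:7:] + pI + pI * (2 * pK + [:12:]) + pcompose pR pB) ?n * T J"
    unfolding K_def by (simp add: poly_pcompose algebra_simps)
  finally have "runs_within orc (program i c d f A) (enc a) (enc (result st))
      (poly ([:7:] + pI + pI * (2 * pK + [:12:]) + pcompose pR pB) ?n * T J)"
    unfolding program_def
    by (intro runs_withinI[OF exec_within_mono[OF exec_within_Seq[OF 1 exec_within_Seq[OF 2 3]]]]) auto
  moreover obtain a' H best where "st = ([], a', H, best)"
    using st(2) by (cases st) auto
  moreover obtain S U where "result st = (S, U)" by (meson surj_pair)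
  ultimately show ?thesis
    using result_approx[OF _ fam] st(1) J by (metis (no_types, lifting) mem_Collect_eq)
qed

text \<open>The polynomial can precede \<open>A\<close> because \<open>i\<close>, \<open>c\<close>,
  \<open>d\<close> and \<open>f\<close> are fixed programs and \<open>A\<close> is merely
  called.\<close>

theorem theorem1:
  "\<exists>p :: nat poly. \<forall>A :: com. \<exists>B :: com.
     \<forall>(orc :: tree \<Rightarrow> bool) (\<phi> :: tree) (I :: supplier) (T :: pcm \<Rightarrow> nat).
       supplier_instance I \<longrightarrow>
       (\<forall>J \<in> pcm_instances_of I. pcm_solves_within orc \<phi> A J (T J)) \<longrightarrow>
       (\<forall>a. supplier_input \<phi> I a \<longrightarrow>
          (\<exists>b t X. runs orc B a b t \<and> supplier_output X b \<and> approx_solution 3 I X \<and>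
             (\<exists>J \<in> pcm_instances_of I. t \<le> poly p (cells a) * T J)))"
proof -
  obtain i pI c pQ d pS f pR where comps: "computes i init_state pI" "computes c state_query pQ"
    "computes d (\<lambda>z. step (fst z) (snd z)) pS" "computes f result pR"
    using ptime_init_state ptime_state_query ptime_step ptime_result unfolding ptime_def by blast
  define pB where "pB = pI + pI * [:4, 5, 1:]"
  define pK where "pK = pcompose pQ pB + pcompose pS ([:1, 1:] + pB)"
  let ?p = "[:7:] + pI + pI * (2 * pK + [:12:]) + pcompose pR pB"
  show ?thesis
  proof (intro exI[of _ ?p] allI exI[of _ "program i c d f _"] impI)
    fix A orc \<phi> I T b
    assume I: "supplier_instance I" and b: "supplier_input \<phi> I b"
      and A: "\<forall>J\<in>pcm_instances_of I. pcm_solves_within orc \<phi> A J (T J)"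
    obtain a where a: "b = enc a" "in_desc a = \<phi>" "encoded_instance I a"
      using supplier_input_decode[OF I b] .
    interpret encoded_instance I a by (rule a(3))
    obtain S U J where J: "J \<in> pcm_instances_of I"
      and SU: "distinct S" "distinct U" "approx_solution 3 I (set S, set U)"
      and run: "runs_within orc (program i c d f A) (enc a) (enc (S, U)) (poly ?p (sz a) * T J)"
      using program_correct[OF _ comps, of orc A T] A a(2) unfolding pB_def pK_def by blast
    have "supplier_output (set S, set U) (enc (S, U))"
      using SU(1,2) unfolding supplier_output_def repr_pair_def repr_nat_set_enc by auto
    then show "\<exists>b' t X. runs orc (program i c d f A) b b' t \<and> supplier_output X b' \<and>
        approx_solution 3 I X \<and> (\<exists>J\<in>pcm_instances_of I. t \<le> poly ?p (cells b) * T J)"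
      using run J SU(3) a(1) unfolding runs_within_def by blast
  qed
qed

end
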